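(* Let $I\subseteq\mathbb{R}$ be an interval with $0\in I$, and let $f,h:I\to\mathbb{R}$ be continuous functions such that $f$ is matrix convex with $f(0)\le 0$, and $h$ is matrix concave with $h>0$ (that is, $h(t)>0$ for all $t\in I$). For commuting strictly positive $n\times n$ matrices $L,R$ such that the spectrum of $R$ and the spectrum of $\frac{L}{h(R)}:=L\,h(R)^{-1}$ lie in $I$, define $$(f\Delta h)(L,R)=f\left(\frac{L}{h(R)}\right)h(R).$$ Then $(L,R)\mapsto (f\Delta h)(L,R)$ is jointly convex in the following sense. Let $n\in\mathbb{N}$, let $0\le c\le 1$, and let $L_1,L_2,R_1,R_2$ be strictly positive $n\times n$ matrices with $[L_j,R_j]=0$ and with the spectra of $R_j$ and of $\frac{L_j}{h(R_j)}$ contained in $I$ for $j=1,2$. Put $L=cL_1+(1-c)L_2$ and $R=cR_1+(1-c)R_2$, and suppose that $[L,R]=0$. Then $$(f\Delta h)(L,R)\le c\,(f\Delta h)(L_1,R_1)+(1-c)\,(f\Delta h)(L_2,R_2).$$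
   Context: All matrices are finite complex $n\times n$ matrices. $[L,R]=LR-RL$. A strictly positive matrix ($L>0$) is a self-adjoint positive definite matrix. For self-adjoint $X,Y$, $X\le Y$ means that $Y-X$ is positive semidefinite. For a continuous $f:I\to\mathbb{R}$ on an interval $I$ and a self-adjoint matrix $T$ with spectrum in $I$, $f(T)$ is defined by the spectral functional calculus. The function $f$ is called matrix convex if for every $n\in\mathbb{N}$ the map $T\mapsto f(T)$ is convex on the self-adjoint $n\times n$ matrices with spectrum in $I$, i.e. $f(cT_1+(1-c)T_2)\le c f(T_1)+(1-c)f(T_2)$ for $0\le c\le 1$; $h$ is matrix concave if $-h$ is matrix convex. If $L,R>0$ commute and the spectrum of $R$ lies in $I$, then, since $h>0$, $h(R)$ is strictly positive and commutes with $L$, so $\frac{L}{h(R)}=L\,h(R)^{-1}=h(R)^{-1}L$ is strictly positive. *)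

theory Defs
  imports
    "HOL-Analysis.Topology_Euclidean_Space"
    "Jordan_Normal_Form.Schur_Decomposition"
    "Jordan_Normal_Form.Gauss_Jordan_Elimination"
    "Jordan_Normal_Form.Spectral_Radius"
begin

definition self_adjoint :: "nat \<Rightarrow> complex mat \<Rightarrow> bool" where
  "self_adjoint n A \<longleftrightarrow> A \<in> carrier_mat n n \<and> mat_adjoint A = A"

definition unitary :: "nat \<Rightarrow> complex mat \<Rightarrow> bool" where
  "unitary n U \<longleftrightarrow> U \<in> carrier_mat n n \<and> U * mat_adjoint U = 1\<^sub>m n \<and> mat_adjoint U * U = 1\<^sub>m n"

(* For self-adjoint A the number (A v) \<bullet>c v is real, so taking Re loses nothing. *)

definition positive_semidefinite :: "nat \<Rightarrow> complex mat \<Rightarrow> bool" where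
  "positive_semidefinite n A \<longleftrightarrow>
     self_adjoint n A \<and> (\<forall>v \<in> carrier_vec n. 0 \<le> Re ((A *\<^sub>v v) \<bullet>c v))"

definition strictly_positive :: "nat \<Rightarrow> complex mat \<Rightarrow> bool" where
  "strictly_positive n A \<longleftrightarrow>
     self_adjoint n A \<and> (\<forall>v \<in> carrier_vec n. v \<noteq> 0\<^sub>v n \<longrightarrow> 0 < Re ((A *\<^sub>v v) \<bullet>c v))"

definition loewner_le :: "nat \<Rightarrow> complex mat \<Rightarrow> complex mat \<Rightarrow> bool" where
  "loewner_le n X Y \<longleftrightarrow>
     self_adjoint n X \<and> self_adjoint n Y \<and> positive_semidefinite n (Y - X)"

definition spectrum_in :: "complex mat \<Rightarrow> real set \<Rightarrow> bool" where
  "spectrum_in T I \<longleftrightarrow> spectrum T \<subseteq> complex_of_real ` I"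

(* Spectral functional calculus f(T) = U diag(f d_0, ..., f d_(n-1)) U* for a self-adjoint
   T = U diag(d_0, ..., d_(n-1)) U*.  A diagonalization exists by the spectral theorem and the
   value does not depend on the one chosen, so the description is definite; only the values of
   f on the spectrum of T matter.  Unspecified if T is not self-adjoint. *)

definition mat_fun :: "(real \<Rightarrow> real) \<Rightarrow> complex mat \<Rightarrow> complex mat" where
  "mat_fun f T = (THE S. \<exists>U d. unitary (dim_row T) U \<and>
      T = U * mat_diag (dim_row T) (\<lambda>i. complex_of_real (d i)) * mat_adjoint U \<and>
      S = U * mat_diag (dim_row T) (\<lambda>i. complex_of_real (f (d i))) * mat_adjoint U)"

(* Matrices of size 0 are included; they satisfy the condition trivially. *)

definition matrix_convex :: "real set \<Rightarrow> (real \<Rightarrow> real) \<Rightarrow> bool" where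
  "matrix_convex I f \<longleftrightarrow>
     (\<forall>n T\<^sub>1 T\<^sub>2. \<forall>c::real.
        self_adjoint n T\<^sub>1 \<longrightarrow> self_adjoint n T\<^sub>2 \<longrightarrow>
        spectrum_in T\<^sub>1 I \<longrightarrow> spectrum_in T\<^sub>2 I \<longrightarrow> 0 \<le> c \<longrightarrow> c \<le> 1 \<longrightarrow>
        loewner_le n
          (mat_fun f (complex_of_real c \<cdot>\<^sub>m T\<^sub>1 + complex_of_real (1 - c) \<cdot>\<^sub>m T\<^sub>2))
          (complex_of_real c \<cdot>\<^sub>m mat_fun f T\<^sub>1 + complex_of_real (1 - c) \<cdot>\<^sub>m mat_fun f T\<^sub>2))"

definition matrix_concave :: "real set \<Rightarrow> (real \<Rightarrow> real) \<Rightarrow> bool" where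
  "matrix_concave I h \<longleftrightarrow> matrix_convex I (\<lambda>t. - h t)"

(* L h(R)^(-1); the option is None only if h(R) is singular. *)

definition mat_quot :: "(real \<Rightarrow> real) \<Rightarrow> complex mat \<Rightarrow> complex mat \<Rightarrow> complex mat" where
  "mat_quot h L R = L * the (mat_inverse (mat_fun h R))"

definition perspective :: "(real \<Rightarrow> real) \<Rightarrow> (real \<Rightarrow> real) \<Rightarrow> complex mat \<Rightarrow> complex mat \<Rightarrow> complex mat" where
  "perspective f h L R = mat_fun f (mat_quot h L R) * mat_fun h R"

end

theory Submission
  imports Defs
begin

text \<open>Write \<open>r = h(R)\<^bsup>1/2\<^esup>\<close>, \<open>q = h(R)\<^bsup>-1/2\<^esup>\<close> and likewise \<open>r\<^sub>j\<close>, \<open>q\<^sub>j\<close> for \<open>R\<^sub>j\<close>, and put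
  \<open>T\<^sub>j = L\<^sub>j / h(R\<^sub>j) = q\<^sub>j L\<^sub>j q\<^sub>j\<close>. By concavity of \<open>h\<close> the matrices \<open>A\<^sub>j = c\<^sub>j\<^bsup>1/2\<^esup> r\<^sub>j q\<close>
  (with \<open>c\<^sub>1 = c\<close>, \<open>c\<^sub>2 = 1 - c\<close>) satisfy \<open>A\<^sub>1\<^sup>* A\<^sub>1 + A\<^sub>2\<^sup>* A\<^sub>2 \<le> 1\<close>, and
  \<open>A\<^sub>1\<^sup>* T\<^sub>1 A\<^sub>1 + A\<^sub>2\<^sup>* T\<^sub>2 A\<^sub>2 = q L q = L / h(R)\<close>. The Hansen-Pedersen form of Jensen's inequality
  bounds \<open>f\<close> of this matrix by \<open>A\<^sub>1\<^sup>* f(T\<^sub>1) A\<^sub>1 + A\<^sub>2\<^sup>* f(T\<^sub>2) A\<^sub>2\<close>; multiplying by \<open>r\<close> on both sides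
  gives the claim. Jensen's inequality is reduced, by adding a third column entry
  \<open>D = (1 - A\<^sub>1\<^sup>* A\<^sub>1 - A\<^sub>2\<^sup>* A\<^sub>2)\<^bsup>1/2\<^esup>\<close> paired with the zero matrix (where \<open>f(0) \<le> 0\<close> enters), to an isometry.\<close>

unbundle no vec_syntax

section \<open>Adjoints and matrix algebra\<close>

text \<open>The side conditions of this and the following laws are equations between dimensions that
  mention only the given matrices, so the simplifier can discharge them for rectangular products
  without guessing carrier sizes.\<close>

lemma assoc_mult_mat_dim:
  fixes A :: "'a :: semiring_0 mat"
  assumes "dim_col A = dim_row B" "dim_col B = dim_row C"
  shows "A * B * C = A * (B * C)"
  using assms by (intro assoc_mult_mat[of _ "dim_row A" "dim_row B" _ "dim_row C" _ "dim_col C"]) auto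

lemma mult_add_distrib_mat_dim:
  fixes A :: "'a :: semiring_0 mat"
  assumes "dim_col A = dim_row B" "dim_row B = dim_row C" "dim_col B = dim_col C"
  shows "A * (B + C) = A * B + A * C"
  using assms by (intro mult_add_distrib_mat[of _ "dim_row A" "dim_row B" _ "dim_col C"]) auto

lemma add_mult_distrib_mat_dim:
  fixes A :: "'a :: semiring_0 mat"
  assumes "dim_col A = dim_row C" "dim_row A = dim_row B" "dim_col A = dim_col B"
  shows "(A + B) * C = A * C + B * C"
  using assms by (intro add_mult_distrib_mat[of _ "dim_row A" "dim_row C" _ _ "dim_col C"]) auto

lemma mult_minus_distrib_mat_dim:
  fixes A :: "'a :: ring mat"
  assumes "dim_col A = dim_row B" "dim_row B = dim_row C" "dim_col B = dim_col C"
  shows "A * (B - C) = A * B - A * C"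
  using assms by (intro mult_minus_distrib_mat[of _ "dim_row A" "dim_row B" _ "dim_col C"]) auto

lemma minus_mult_distrib_mat_dim:
  fixes A :: "'a :: ring mat"
  assumes "dim_col A = dim_row C" "dim_row A = dim_row B" "dim_col A = dim_col B"
  shows "(A - B) * C = A * C - B * C"
  using assms by (intro minus_mult_distrib_mat[of _ "dim_row A" "dim_row C" _ _ "dim_col C"]) auto

lemma mult_smult_distrib_dim:
  fixes A :: "'a :: comm_semiring_0 mat"
  assumes "dim_col A = dim_row B"
  shows "A * (k \<cdot>\<^sub>m B) = k \<cdot>\<^sub>m (A * B)"
  using assms by (intro mult_smult_distrib[of _ "dim_row A" "dim_row B" _ "dim_col B"]) auto

lemma mult_smult_assoc_mat_dim:
  fixes A :: "'a :: comm_semiring_0 mat"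
  assumes "dim_col A = dim_row B"
  shows "(k \<cdot>\<^sub>m A) * B = k \<cdot>\<^sub>m (A * B)"
  using assms by (intro mult_smult_assoc_mat[of _ "dim_row A" "dim_row B" _ "dim_col B"]) auto

lemma assoc_mult_mat_vec_dim:
  fixes A :: "'a :: semiring_0 mat"
  assumes "dim_col A = dim_row B" "dim_col B = dim_vec v"
  shows "A * B *\<^sub>v v = A *\<^sub>v (B *\<^sub>v v)"
proof (rule assoc_mult_mat_vec)
  show "A \<in> carrier_mat (dim_row A) (dim_row B)" "B \<in> carrier_mat (dim_row B) (dim_vec v)"
    "v \<in> carrier_vec (dim_vec v)"
    using assms by auto
qed

lemma smult_smult_mat: "a \<cdot>\<^sub>m (b \<cdot>\<^sub>m A) = (a * b) \<cdot>\<^sub>m (A :: 'a :: semigroup_mult mat)"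
  by (rule eq_matI) (auto simp: mult.assoc)

lemma one_smult_mat: "1 \<cdot>\<^sub>m A = (A :: 'a :: monoid_mult mat)"
  by (rule eq_matI) auto

lemmas mat_dim_simps =
  assoc_mult_mat_dim mult_add_distrib_mat_dim add_mult_distrib_mat_dim
  mult_minus_distrib_mat_dim minus_mult_distrib_mat_dim
  mult_smult_distrib_dim mult_smult_assoc_mat_dim smult_smult_mat

section \<open>Adjoints, self-adjoint and unitary matrices\<close>

lemma dim_mat_adjoint [simp]:
  "dim_row (mat_adjoint A) = dim_col A" "dim_col (mat_adjoint A) = dim_row A"
  by (simp_all add: mat_adjoint_def)

lemma index_mat_adjoint [simp]:
  "i < dim_col A \<Longrightarrow> j < dim_row A \<Longrightarrow> mat_adjoint A $$ (i, j) = conjugate (A $$ (j, i))"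
  by (simp add: mat_adjoint_def mat_of_rows_index)

lemma mat_adjoint_carrier [simp]:
  "A \<in> carrier_mat n m \<Longrightarrow> mat_adjoint A \<in> carrier_mat m n"
  by (intro carrier_matI) auto

lemma mat_adjoint_mat_adjoint [simp]: "mat_adjoint (mat_adjoint A) = A"
  by (rule eq_matI) auto

lemma mat_adjoint_one [simp]: "mat_adjoint (1\<^sub>m n :: complex mat) = 1\<^sub>m n"
  by (rule eq_matI) auto

lemma mat_adjoint_zero [simp]: "mat_adjoint (0\<^sub>m n m :: complex mat) = 0\<^sub>m m n"
  by (rule eq_matI) auto

lemma mat_adjoint_mult:
  fixes A :: "complex mat"
  assumes "dim_col A = dim_row B"
  shows "mat_adjoint (A * B) = mat_adjoint B * mat_adjoint A"
  using assms by (intro eq_matI) (auto simp: scalar_prod_def mult.commute)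

lemma mat_adjoint_add:
  fixes A :: "complex mat"
  assumes "dim_row A = dim_row B" "dim_col A = dim_col B"
  shows "mat_adjoint (A + B) = mat_adjoint A + mat_adjoint B"
  using assms by (intro eq_matI) auto

lemma mat_adjoint_minus:
  fixes A :: "complex mat"
  assumes "dim_row A = dim_row B" "dim_col A = dim_col B"
  shows "mat_adjoint (A - B) = mat_adjoint A - mat_adjoint B"
  using assms by (intro eq_matI) auto

lemma mat_adjoint_smult_real:
  "mat_adjoint (complex_of_real k \<cdot>\<^sub>m A) = complex_of_real k \<cdot>\<^sub>m mat_adjoint A"
  by (rule eq_matI) auto

lemma mat_adjoint_mat_diag_real:
  "mat_adjoint (mat_diag n (\<lambda>i. complex_of_real (d i))) = mat_diag n (\<lambda>i. complex_of_real (d i))"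
  by (rule eq_matI) (auto simp: mat_diag_def)

lemmas adjoint_dim_simps = mat_adjoint_mult mat_adjoint_add mat_adjoint_minus mat_adjoint_smult_real

lemma cscalar_prod_mat_adjoint:
  fixes A :: "complex mat"
  assumes "dim_vec v = dim_col A" "dim_vec w = dim_row A"
  shows "(A *\<^sub>v v) \<bullet>c w = v \<bullet>c (mat_adjoint A *\<^sub>v w)"
proof -
  have "(A *\<^sub>v v) \<bullet>c w = (\<Sum>i<dim_row A. \<Sum>j<dim_col A. A $$ (i, j) * v $ j * cnj (w $ i))"
    using assms by (auto simp: scalar_prod_def sum_distrib_right atLeast0LessThan intro!: sum.cong)
  also have "\<dots> = (\<Sum>j<dim_col A. \<Sum>i<dim_row A. A $$ (i, j) * v $ j * cnj (w $ i))"
    by (rule sum.swap)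
  also have "\<dots> = v \<bullet>c (mat_adjoint A *\<^sub>v w)"
    using assms by (auto simp: scalar_prod_def sum_distrib_left atLeast0LessThan intro!: sum.cong)
  finally show ?thesis .
qed

lemma self_adjointD:
  assumes "self_adjoint n A"
  shows "A \<in> carrier_mat n n" "dim_row A = n" "dim_col A = n" "mat_adjoint A = A"
  using assms by (auto simp: self_adjoint_def)

lemma unitaryD:
  assumes "unitary n U"
  shows "U \<in> carrier_mat n n" "dim_row U = n" "dim_col U = n"
    "U * mat_adjoint U = 1\<^sub>m n" "mat_adjoint U * U = 1\<^sub>m n"
  using assms by (auto simp: unitary_def)

text \<open>Once \<open>mat_dim_simps\<close> has nested products to the right, inverse pairs meet
  in this form. The row count of \<open>C\<close> comes from comparing column counts in
  \<open>A * B = 1\<^sub>m (dim_row A)\<close>.\<close>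

lemma mult_mat_left_cancel:
  fixes A :: "'a :: semiring_1 mat"
  assumes "A * B = 1\<^sub>m (dim_row A)" "dim_col A = dim_row B" "dim_col B = dim_row C"
  shows "A * (B * C) = C"
proof -
  have "A * (B * C) = A * B * C" by (rule assoc_mult_mat_dim[symmetric]) (use assms in auto)
  moreover have "dim_row C = dim_row A" using assms(1,3) by (metis index_mult_mat(3) index_one_mat(3))
  ultimately show ?thesis using assms(1) by simp
qed

lemma self_adjoint_congruence:
  assumes "self_adjoint n A" "V \<in> carrier_mat n m"
  shows "self_adjoint m (mat_adjoint V * A * V)"
  using assms by (auto simp: self_adjoint_def adjoint_dim_simps mat_dim_simps)

lemma unitary_mult:
  assumes "unitary n U" "unitary n V"
  shows "unitary n (U * V)"
proof -
  note dims = unitaryD[OF assms(1)] unitaryD[OF assms(2)]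
  have "U * V * mat_adjoint (U * V) = U * (V * (mat_adjoint V * mat_adjoint U))"
    "mat_adjoint (U * V) * (U * V) = mat_adjoint V * (mat_adjoint U * (U * V))"
    using dims by (simp_all add: adjoint_dim_simps mat_dim_simps)
  moreover have "V * (mat_adjoint V * mat_adjoint U) = mat_adjoint U"
    "mat_adjoint U * (U * V) = V"
    using dims by (simp_all add: mult_mat_left_cancel)
  ultimately show ?thesis using dims by (simp add: unitary_def)
qed

section \<open>Unitary diagonalization\<close>

text \<open>After completing \<open>v\<close> to a basis, Gram-Schmidt leaves the first vector
  unchanged; normalising the resulting orthogonal vectors gives the columns of \<open>U\<close>. The
  factor \<open>a\<close> arises as the reciprocal of the norm of \<open>v\<close>.\<close>

lemma nonzero_vector_unitary_completion:
  fixes v :: "complex vec"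
  assumes v: "v \<in> carrier_vec n" "v \<noteq> 0\<^sub>v n"
  obtains U a where "unitary n U" "col U 0 = a \<cdot>\<^sub>v v"
proof -
  interpret cof_vec_space n "TYPE(complex)" .
  define b where "b = basis_completion v"
  define ws where "ws = gram_schmidt n b"
  note bc = basis_completion[OF v, folded b_def]
  have n: "n > 0"
    using v by (cases n) auto
  then obtain vs where bv: "b = v # vs"
    using bc(6,7) by (cases b) auto
  note gs = gram_schmidt_result[OF bc(2,4,5) refl, folded ws_def]
  have len: "length ws = n"
    using gs(4) bc(6) by simp
  have hd: "ws ! 0 = v"
    using gram_schmidt_hd[OF v(1), of vs, folded bv] len n
    by (metis hd_conv_nth length_greater_0_conv ws_def)
  have ws: "ws ! i \<in> carrier_vec n" if "i < n" for i
    using gs(3) len that by auto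
  define r where "r i = (1 / complex_of_real (sqrt (Re (ws ! i \<bullet>c ws ! i))))" for i
  define U where "U = mat n n (\<lambda>(i, j). r j * (ws ! j) $ i)"
  have U: "U \<in> carrier_mat n n"
    by (simp add: U_def)
  have U_adj_U: "mat_adjoint U * U = 1\<^sub>m n"
  proof (rule eq_matI)
    fix i j assume "i < dim_row (1\<^sub>m n :: complex mat)" "j < dim_col (1\<^sub>m n :: complex mat)"
    then have ij: "i < n" "j < n"
      by auto
    have "(mat_adjoint U * U) $$ (i, j) = cnj (r i) * r j * (ws ! j \<bullet>c ws ! i)"
      using ij ws[of i] ws[of j]
      by (auto simp: U_def scalar_prod_def sum_distrib_left mult_ac intro!: sum.cong)
    also have "\<dots> = 1\<^sub>m n $$ (i, j)"
    proof (cases "i = j")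
      case True
      have "ws ! i \<noteq> 0\<^sub>v n"
        using corthogonalD[OF gs(2), of i i] ij len ws[of i] by auto
      then have "0 < ws ! i \<bullet>c ws ! i"
        using ws[of i] ij by simp
      then obtain x where x: "ws ! i \<bullet>c ws ! i = complex_of_real x" "x > 0"
        by (metis Re_complex_of_real complex_is_Real_iff less_complex_def of_real_Re zero_complex.sel)
      have r: "r i = complex_of_real (1 / sqrt x)"
        by (simp add: r_def x(1))
      have "cnj (r i) * r i * complex_of_real x = complex_of_real (1 / sqrt x * (1 / sqrt x) * x)"
        unfolding r by (simp only: complex_cnj_complex_of_real of_real_mult)
      also have "1 / sqrt x * (1 / sqrt x) * x = 1"
        using x(2) by (simp add: field_simps)
      finally show ?thesis
        using True ij x by simp
    next
      case False
      then show ?thesis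
        using corthogonalD[OF gs(2), of j i] ij len by simp
    qed
    finally show "(mat_adjoint U * U) $$ (i, j) = 1\<^sub>m n $$ (i, j)" .
  qed (auto simp: U_def)
  then have "U * mat_adjoint U = 1\<^sub>m n"
    using U mat_adjoint_carrier[OF U] mat_mult_left_right_inverse by blast
  then have "unitary n U"
    using U U_adj_U by (simp add: unitary_def)
  moreover have "col U 0 = r 0 \<cdot>\<^sub>v v"
    using n v hd by (intro eq_vecI) (auto simp: U_def)
  ultimately show ?thesis
    using that by blast
qed

text \<open>Moving \<open>A\<close> across the inner product gives e <v,v> = cnj e <v,v>, and <v,v>
  is nonzero.\<close>

lemma self_adjoint_eigenvalue_real:
  assumes A: "self_adjoint n A" and ev: "eigenvector A v e"
  shows "e = complex_of_real (Re e)"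
proof -
  note dA = self_adjointD[OF A]
  have v: "v \<in> carrier_vec n" "v \<noteq> 0\<^sub>v n" "A *\<^sub>v v = e \<cdot>\<^sub>v v"
    using ev dA by (auto simp: eigenvector_def)
  have "(A *\<^sub>v v) \<bullet>c v = v \<bullet>c (A *\<^sub>v v)"
    using cscalar_prod_mat_adjoint[of v A v] dA v by auto
  then have "e * (v \<bullet>c v) = cnj e * (v \<bullet>c v)"
    using v(1) unfolding v(3) by (simp add: conjugate_smult_vec)
  moreover have "v \<bullet>c v \<noteq> 0"
    using v by simp
  ultimately have "e = cnj e"
    by simp
  then show ?thesis
    by (simp add: complex_eq_iff)
qed

text \<open>Deflation, by induction on the dimension: in an orthonormal basis that begins with an
  eigenvector, \<open>A\<close> becomes block diagonal with a real 1 x 1 corner \<open>e\<close> and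
  a self-adjoint block \<open>C\<close> of size \<open>n\<close>, to which the induction hypothesis
  applies.\<close>

theorem self_adjoint_unitarily_diagonalizable:
  assumes "self_adjoint n A"
  shows "\<exists>U d. unitary n U \<and>
    A = U * mat_diag n (\<lambda>i. complex_of_real (d i)) * mat_adjoint U"
  using assms
proof (induction n arbitrary: A)
  case 0
  then have "unitary 0 (1\<^sub>m 0) \<and> A = 1\<^sub>m 0 * mat_diag 0 (\<lambda>i. complex_of_real 0) * mat_adjoint (1\<^sub>m 0)"
    using self_adjointD[OF 0] by (auto simp: unitary_def intro!: eq_matI)
  then show ?case
    by (intro exI)
next
  case (Suc n)
  note dA = self_adjointD[OF Suc.prems]
  obtain e where "eigenvalue A e"
    using spectrum_non_empty[OF dA(1)] by (auto simp: spectrum_def)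
  then obtain v where ev: "eigenvector A v e"
    by (auto simp: eigenvalue_def)
  then have v: "v \<in> carrier_vec (Suc n)" "v \<noteq> 0\<^sub>v (Suc n)" "A *\<^sub>v v = e \<cdot>\<^sub>v v"
    using dA by (auto simp: eigenvector_def)
  obtain U a where U: "unitary (Suc n) U" and U0: "col U 0 = a \<cdot>\<^sub>v v"
    using nonzero_vector_unitary_completion[OF v(1,2)] .
  note dU = unitaryD[OF U]
  define B where "B = mat_adjoint U * A * U"
  have B: "self_adjoint (Suc n) B"
    unfolding B_def using Suc.prems dU(1) by (rule self_adjoint_congruence)
  note dB = self_adjointD[OF B]
  have "col B 0 = (mat_adjoint U * A) *\<^sub>v col U 0"
    unfolding B_def using dU dA by (intro col_mult2[of _ "Suc n" "Suc n" _ "Suc n"]) auto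
  also have "\<dots> = mat_adjoint U *\<^sub>v (A *\<^sub>v col U 0)"
    using dU dA by (intro assoc_mult_mat_vec_dim) auto
  also have "A *\<^sub>v col U 0 = e \<cdot>\<^sub>v col U 0"
    using v dA unfolding U0 by (simp add: mult_mat_vec[of _ "Suc n" "Suc n"] smult_smult_assoc mult.commute)
  also have "mat_adjoint U *\<^sub>v (e \<cdot>\<^sub>v col U 0) = e \<cdot>\<^sub>v (mat_adjoint U *\<^sub>v col U 0)"
    using dU by (intro mult_mat_vec) auto
  also have "mat_adjoint U *\<^sub>v col U 0 = col (mat_adjoint U * U) 0"
    using dU by (intro col_mult2[symmetric]) auto
  finally have colB: "col B 0 = e \<cdot>\<^sub>v unit_vec (Suc n) 0"
    using dU by simp
  have B0: "B $$ (i, 0) = (if i = 0 then e else 0)" if "i < Suc n" for i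
    using arg_cong[OF colB, of "\<lambda>w. w $ i"] that dB by auto
  \<comment> \<open>Self-adjointness turns the vanishing of the first column below the corner into
    the vanishing of the first row beside it; at the corner itself the reality of \<open>e\<close>
    is used.\<close>
  have B0': "B $$ (0, i) = (if i = 0 then e else 0)" if "i < Suc n" for i
  proof -
    have "B $$ (0, i) = cnj (B $$ (i, 0))"
      using that dB index_mat_adjoint[of 0 B i] by simp
    then show ?thesis
      using B0[OF that] self_adjoint_eigenvalue_real[OF Suc.prems ev]
      by (metis complex_cnj_complex_of_real complex_cnj_zero)
  qed
  define C where "C = mat n n (\<lambda>(i, j). B $$ (Suc i, Suc j))"
  have "self_adjoint n C"
  proof -
    have "mat_adjoint C = C"
    proof (rule eq_matI)
      fix i j assume "i < dim_row C" "j < dim_col C"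
      then show "mat_adjoint C $$ (i, j) = C $$ (i, j)"
        using dB index_mat_adjoint[of "Suc i" B "Suc j"] by (simp add: C_def)
    qed (auto simp: C_def)
    then show ?thesis
      by (simp add: self_adjoint_def C_def)
  qed
  then obtain P d where P: "unitary n P"
    and C: "C = P * mat_diag n (\<lambda>i. complex_of_real (d i)) * mat_adjoint P"
    using Suc.IH by blast
  note dP = unitaryD[OF P]
  define Q where "Q = four_block_mat (1\<^sub>m 1) (0\<^sub>m 1 n) (0\<^sub>m n 1) P"
  define d' where "d' i = (case i of 0 \<Rightarrow> Re e | Suc j \<Rightarrow> d j)" for i
  have Q: "Q \<in> carrier_mat (Suc n) (Suc n)"
    using dP by (auto simp: Q_def intro!: carrier_matI)
  have Q_adj: "mat_adjoint Q = four_block_mat (1\<^sub>m 1) (0\<^sub>m 1 n) (0\<^sub>m n 1) (mat_adjoint P)"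
    using dP by (intro eq_matI) (auto simp: Q_def)
  have diag: "mat_diag (Suc n) (\<lambda>i. complex_of_real (d' i)) =
    four_block_mat (e \<cdot>\<^sub>m 1\<^sub>m 1) (0\<^sub>m 1 n) (0\<^sub>m n 1) (mat_diag n (\<lambda>i. complex_of_real (d i)))"
    using self_adjoint_eigenvalue_real[OF Suc.prems ev]
    by (intro eq_matI) (auto simp: mat_diag_def d'_def split: nat.split)
  \<comment> \<open>Corners are written as multiples of the identity so that one formula covers
    \<open>Q\<close>, its adjoint and the diagonal factor; \<open>block_mult1\<close> collects the
    instances in which one or both corners are 1.\<close>
  have block_mult: "four_block_mat (a \<cdot>\<^sub>m 1\<^sub>m 1) (0\<^sub>m 1 n) (0\<^sub>m n 1) X * four_block_mat (b \<cdot>\<^sub>m 1\<^sub>m 1) (0\<^sub>m 1 n) (0\<^sub>m n 1) Y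
      = four_block_mat ((a * b) \<cdot>\<^sub>m 1\<^sub>m 1) (0\<^sub>m 1 n) (0\<^sub>m n 1) (X * Y)"
    if "X \<in> carrier_mat n n" "Y \<in> carrier_mat n n" for a b :: complex and X Y
    using that
    by (subst mult_four_block_mat[of _ 1 1 _ n _ n _ _ 1 _ n])
      (auto simp: mat_dim_simps left_add_zero_mat[of _ 1 1] right_add_zero_mat[of _ n n]
         left_add_zero_mat[of _ n n] right_add_zero_mat[of _ 1 1])
  note block_mult1 = block_mult[of _ _ 1, unfolded one_smult_mat] block_mult[of _ _ _ 1, unfolded one_smult_mat]
    block_mult[of _ _ 1 1, unfolded one_smult_mat]
  have one: "1\<^sub>m (Suc n) = four_block_mat (1\<^sub>m 1) (0\<^sub>m 1 n) (0\<^sub>m n 1) (1\<^sub>m n :: complex mat)"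
    by (intro eq_matI) auto
  have "unitary (Suc n) Q"
    unfolding unitary_def Q_adj unfolding one
    using dP Q by (simp add: Q_def block_mult1 one_smult_mat del: One_nat_def)
  then have UQ: "unitary (Suc n) (U * Q)"
    using U by (rule unitary_mult[rotated])
  have "B = four_block_mat (e \<cdot>\<^sub>m 1\<^sub>m 1) (0\<^sub>m 1 n) (0\<^sub>m n 1) C"
    using dB B0 B0' by (intro eq_matI) (auto simp: C_def)
  also have "\<dots> = Q * mat_diag (Suc n) (\<lambda>i. complex_of_real (d' i)) * mat_adjoint Q"
    unfolding Q_adj diag C unfolding Q_def
    using dP by (simp add: block_mult1 del: One_nat_def)
  finally have BQ: "B = Q * mat_diag (Suc n) (\<lambda>i. complex_of_real (d' i)) * mat_adjoint Q" .
  have "U * B * mat_adjoint U = (U * mat_adjoint U) * A * (U * mat_adjoint U)"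
    unfolding B_def using dU(1-3) dA(1-3) by (simp add: mat_dim_simps)
  also have "\<dots> = A"
    using dU dA by simp
  finally have "A = U * B * mat_adjoint U" ..
  also have "\<dots> = (U * Q) * mat_diag (Suc n) (\<lambda>i. complex_of_real (d' i)) * mat_adjoint (U * Q)"
    unfolding BQ using dU(1-3) Q carrier_matD[OF mat_diag_dim[of "Suc n" "\<lambda>i. complex_of_real (d' i)"]]
    by (simp add: mat_dim_simps adjoint_dim_simps)
  finally show ?case
    using UQ by blast
qed

section \<open>Functional calculus\<close>

lemma dim_mat_diag [simp]: "dim_row (mat_diag n d) = n" "dim_col (mat_diag n d) = n"
  by (simp_all add: mat_diag_def)

text \<open>In the two eigenbases \<open>M\<close> becomes K = U* M W, and the hypothesis reads a_i
  K_ij = K_ij b_j. So K_ij = 0 or a_i = b_j, and in either case a_i and b_j may be replaced by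
  f(a_i) and f(b_j).\<close>

lemma diagonalization_intertwines:
  assumes U: "unitary N U" and W: "unitary n W" and M: "M \<in> carrier_mat N n"
    and eq: "(U * mat_diag N (\<lambda>i. complex_of_real (a i)) * mat_adjoint U) * M =
      M * (W * mat_diag n (\<lambda>i. complex_of_real (b i)) * mat_adjoint W)"
  shows "(U * mat_diag N (\<lambda>i. complex_of_real (f (a i))) * mat_adjoint U) * M =
      M * (W * mat_diag n (\<lambda>i. complex_of_real (f (b i))) * mat_adjoint W)"
proof -
  note dims = unitaryD(1-3)[OF U] unitaryD(1-3)[OF W] carrier_matD[OF M]
  have inv: "mat_adjoint U * (U * X) = X" "U * (mat_adjoint U * X) = X" if "dim_row X = N" for X
    using unitaryD[OF U] that by (simp_all add: mult_mat_left_cancel)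
  have inv': "mat_adjoint W * (W * X) = X" "W * (mat_adjoint W * X) = X" if "dim_row X = n" for X
    using unitaryD[OF W] that by (simp_all add: mult_mat_left_cancel)
  define K where "K = mat_adjoint U * (M * W)"
  have K: "K \<in> carrier_mat N n"
    using dims by (auto simp: K_def intro!: carrier_matI)
  have MW: "M = U * (K * mat_adjoint W)"
    using dims unitaryD[OF W] by (simp add: K_def mat_dim_simps inv)
  have "mat_diag N (\<lambda>i. complex_of_real (a i)) * K =
      mat_adjoint U * (((U * mat_diag N (\<lambda>i. complex_of_real (a i)) * mat_adjoint U) * M) * W)"
    using dims K by (simp add: K_def mat_dim_simps inv)
  also have "\<dots> = K * mat_diag n (\<lambda>i. complex_of_real (b i))"
    unfolding eq using dims unitaryD[OF W] by (simp add: K_def mat_dim_simps)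
  finally have eqK: "mat_diag N (\<lambda>i. complex_of_real (a i)) * K = K * mat_diag n (\<lambda>i. complex_of_real (b i))" .
  have entry_ab: "complex_of_real (a i) * K $$ (i, j) = K $$ (i, j) * complex_of_real (b j)"
    if "i < N" "j < n" for i j
    using arg_cong[OF eqK, of "\<lambda>A. A $$ (i, j)"] that
    by (simp add: mat_diag_mult_left[OF K] mat_diag_mult_right[OF K])
  have entry: "complex_of_real (f (a i)) * K $$ (i, j) = K $$ (i, j) * complex_of_real (f (b j))"
    if "i < N" "j < n" for i j
    using entry_ab[OF that] by (cases "K $$ (i, j) = 0") auto
  have "mat_diag N (\<lambda>i. complex_of_real (f (a i))) * K = K * mat_diag n (\<lambda>i. complex_of_real (f (b i)))"
    by (rule eq_matI) (use entry K in \<open>auto simp: mat_diag_mult_left[OF K] mat_diag_mult_right[OF K]\<close>)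
  then have "U * (mat_diag N (\<lambda>i. complex_of_real (f (a i))) * K) * mat_adjoint W =
      U * (K * mat_diag n (\<lambda>i. complex_of_real (f (b i)))) * mat_adjoint W"
    by simp
  then show ?thesis
    using dims carrier_matD[OF K] by (subst (1 2) MW) (simp add: mat_dim_simps inv inv')
qed

text \<open>Uniqueness for the definite description: two diagonalizations of the same
  \<open>T\<close> are intertwined by the identity matrix, so they yield the same value of
  \<open>f\<close>.\<close>

lemma mat_fun_eqI:
  assumes U: "unitary n U" and T: "T = U * mat_diag n (\<lambda>i. complex_of_real (d i)) * mat_adjoint U"
  shows "mat_fun f T = U * mat_diag n (\<lambda>i. complex_of_real (f (d i))) * mat_adjoint U"
proof -
  have dT: "dim_row T = n"
    using unitaryD[OF U] T by simp
  show ?thesis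
    unfolding mat_fun_def dT
  proof (rule the_equality)
    fix S
    assume "\<exists>W b. unitary n W \<and> T = W * mat_diag n (\<lambda>i. complex_of_real (b i)) * mat_adjoint W \<and>
      S = W * mat_diag n (\<lambda>i. complex_of_real (f (b i))) * mat_adjoint W"
    then obtain W b where W: "unitary n W"
      and TW: "T = W * mat_diag n (\<lambda>i. complex_of_real (b i)) * mat_adjoint W"
      and S: "S = W * mat_diag n (\<lambda>i. complex_of_real (f (b i))) * mat_adjoint W"
      by blast
    have "W * mat_diag n (\<lambda>i. complex_of_real (b i)) * mat_adjoint W * 1\<^sub>m n =
        1\<^sub>m n * (U * mat_diag n (\<lambda>i. complex_of_real (d i)) * mat_adjoint U)"
      unfolding T[symmetric] TW[symmetric] using unitaryD[OF U] T by simp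
    from diagonalization_intertwines[OF W U one_carrier_mat this, of f]
    show "S = U * mat_diag n (\<lambda>i. complex_of_real (f (d i))) * mat_adjoint U"
      using unitaryD[OF U] unitaryD[OF W] S by simp
  qed (use assms in blast)
qed

text \<open>The main tool for the functional calculus. With \<open>Y = Z\<close> it passes from
  matrices that commute with \<open>Y\<close> to matrices that commute with f(Y); with an isometry
  \<open>M\<close> it makes \<open>f\<close> compatible with restriction to an invariant
  subspace.\<close>

lemma mat_fun_intertwines:
  assumes Y: "self_adjoint N Y" and Z: "self_adjoint n Z" and M: "M \<in> carrier_mat N n"
    and eq: "Y * M = M * Z"
  shows "mat_fun f Y * M = M * mat_fun f Z"
proof -
  obtain U a where U: "unitary N U" and Ya: "Y = U * mat_diag N (\<lambda>i. complex_of_real (a i)) * mat_adjoint U"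
    using self_adjoint_unitarily_diagonalizable[OF Y] by blast
  obtain W b where W: "unitary n W" and Zb: "Z = W * mat_diag n (\<lambda>i. complex_of_real (b i)) * mat_adjoint W"
    using self_adjoint_unitarily_diagonalizable[OF Z] by blast
  show ?thesis
    using diagonalization_intertwines[OF U W M eq[unfolded Ya Zb]]
    by (simp add: mat_fun_eqI[OF U Ya] mat_fun_eqI[OF W Zb])
qed

lemma unitary_diag_self_adjoint:
  assumes "unitary n U"
  shows "self_adjoint n (U * mat_diag n (\<lambda>i. complex_of_real (d i)) * mat_adjoint U)"
  using unitaryD[OF assms]
  by (auto simp: self_adjoint_def adjoint_dim_simps mat_dim_simps mat_adjoint_mat_diag_real)

lemma mat_fun_self_adjoint:
  assumes "self_adjoint n T"
  shows "self_adjoint n (mat_fun f T)"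
proof -
  obtain U d where U: "unitary n U" and T: "T = U * mat_diag n (\<lambda>i. complex_of_real (d i)) * mat_adjoint U"
    using self_adjoint_unitarily_diagonalizable[OF assms] by blast
  show ?thesis
    unfolding mat_fun_eqI[OF U T] by (rule unitary_diag_self_adjoint[OF U])
qed

lemma mat_fun_mult:
  assumes "self_adjoint n T"
  shows "mat_fun f T * mat_fun g T = mat_fun (\<lambda>t. f t * g t) T"
proof -
  obtain U d where U: "unitary n U" and T: "T = U * mat_diag n (\<lambda>i. complex_of_real (d i)) * mat_adjoint U"
    using self_adjoint_unitarily_diagonalizable[OF assms] by blast
  have inv: "mat_adjoint U * (U * X) = X" if "dim_row X = n" for X
    using unitaryD[OF U] that by (simp_all add: mult_mat_left_cancel)
  have "mat_diag n (\<lambda>i. complex_of_real (f (d i))) * (mat_diag n (\<lambda>i. complex_of_real (g (d i))) * X)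
    = mat_diag n (\<lambda>i. complex_of_real (f (d i) * g (d i))) * X" if "dim_row X = n" for X
    using that by (subst assoc_mult_mat_dim[symmetric]) auto
  then show ?thesis
    using unitaryD[OF U] by (simp add: mat_fun_eqI[OF U T] mat_dim_simps inv)
qed

lemma mat_fun_ident:
  assumes "self_adjoint n T"
  shows "mat_fun (\<lambda>t. t) T = T"
proof -
  obtain U d where U: "unitary n U" and T: "T = U * mat_diag n (\<lambda>i. complex_of_real (d i)) * mat_adjoint U"
    using self_adjoint_unitarily_diagonalizable[OF assms] by blast
  show ?thesis
    unfolding mat_fun_eqI[OF U T] by (rule T[symmetric])
qed

lemma mat_fun_const:
  assumes "self_adjoint n T"
  shows "mat_fun (\<lambda>t. k) T = complex_of_real k \<cdot>\<^sub>m 1\<^sub>m n"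
proof -
  obtain U d where U: "unitary n U" and T: "T = U * mat_diag n (\<lambda>i. complex_of_real (d i)) * mat_adjoint U"
    using self_adjoint_unitarily_diagonalizable[OF assms] by blast
  have "mat_diag n (\<lambda>i. complex_of_real k) = complex_of_real k \<cdot>\<^sub>m 1\<^sub>m n"
    by (rule eq_matI) (auto simp: mat_diag_def)
  then show ?thesis
    using unitaryD[OF U] by (simp add: mat_fun_eqI[OF U T] mat_dim_simps)
qed

lemma mat_fun_uminus:
  assumes "self_adjoint n T"
  shows "mat_fun (\<lambda>t. - f t) T = - mat_fun f T"
proof -
  have "mat_fun (\<lambda>t. - f t) T = mat_fun (\<lambda>t. -1) T * mat_fun f T"
    by (simp add: mat_fun_mult[OF assms])
  also have "\<dots> = - mat_fun f T"
    using self_adjointD[OF mat_fun_self_adjoint[OF assms], of f]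
    by (simp add: mat_fun_const[OF assms] mat_dim_simps) (auto intro!: eq_matI)
  finally show ?thesis .
qed

section \<open>Spectra of self-adjoint matrices\<close>

text \<open>Column \<open>i\<close> of \<open>U\<close> is an eigenvector for \<open>d i\<close>.
  Conversely, an eigenvector \<open>v\<close> for \<open>e\<close> gives a nonzero w = U* v that the
  diagonal matrix scales by \<open>e\<close>, and any nonzero coordinate of \<open>w\<close>
  identifies \<open>e\<close> with some \<open>d i\<close>.\<close>

lemma spectrum_in_diagonalization:
  assumes U: "unitary n U" and T: "T = U * mat_diag n (\<lambda>i. complex_of_real (d i)) * mat_adjoint U"
  shows "spectrum_in T I \<longleftrightarrow> (\<forall>i<n. d i \<in> I)"
proof
  note dU = unitaryD[OF U]
  note dT = self_adjointD(1-3)[OF unitary_diag_self_adjoint[OF U, of d], folded T]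
  have inv: "mat_adjoint U * (U * X) = X" if "dim_row X = n" for X
    using dU that by (simp_all add: mult_mat_left_cancel)
  show "\<forall>i<n. d i \<in> I" if sp: "spectrum_in T I"
  proof (intro allI impI)
    fix i assume i: "i < n"
    have "T *\<^sub>v col U i = col (T * U) i"
      using dT dU i by (intro col_mult2[symmetric, of _ n n _ n]) auto
    also have "T * U = U * mat_diag n (\<lambda>i. complex_of_real (d i))"
      unfolding T using dU by (simp add: mat_dim_simps)
    also have "col \<dots> i = complex_of_real (d i) \<cdot>\<^sub>v col U i"
      using i dU by (intro eq_vecI) (auto simp: mat_diag_mult_right[OF dU(1)])
    finally have "T *\<^sub>v col U i = complex_of_real (d i) \<cdot>\<^sub>v col U i" .
    moreover have "col U i \<noteq> 0\<^sub>v n"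
    proof
      assume "col U i = 0\<^sub>v n"
      moreover have "mat_adjoint U *\<^sub>v col U i = col (mat_adjoint U * U) i"
        using dU i by (intro col_mult2[symmetric, of _ n n _ n]) auto
      moreover have "mat_adjoint U *\<^sub>v 0\<^sub>v n = 0\<^sub>v n"
        using dU by (intro eq_vecI) auto
      ultimately have "col (mat_adjoint U * U) i = 0\<^sub>v n"
        by simp
      then have "unit_vec n i = (0\<^sub>v n :: complex vec)"
        using dU i by simp
      then show False
        using i by (metis index_unit_vec(1) index_zero_vec(1) zero_neq_one)
    qed
    ultimately have "complex_of_real (d i) \<in> spectrum T"
      using dT dU i by (auto simp: spectrum_def eigenvalue_def eigenvector_def intro!: exI[of _ "col U i"])
    then show "d i \<in> I"
      using sp by (auto simp: spectrum_in_def)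
  qed
  show "spectrum_in T I" if d: "\<forall>i<n. d i \<in> I"
    unfolding spectrum_in_def
  proof
    fix e assume "e \<in> spectrum T"
    then obtain v where v: "v \<in> carrier_vec n" "v \<noteq> 0\<^sub>v n" "T *\<^sub>v v = e \<cdot>\<^sub>v v"
      using dT by (auto simp: spectrum_def eigenvalue_def eigenvector_def)
    define w where "w = mat_adjoint U *\<^sub>v v"
    have w: "w \<in> carrier_vec n"
      unfolding w_def using mat_adjoint_carrier[OF dU(1)] v(1) by (rule mult_mat_vec_carrier)
    have Uw: "U *\<^sub>v w = v"
      unfolding w_def using dU v by (simp add: assoc_mult_mat_vec_dim[symmetric])
    have "w \<noteq> 0\<^sub>v n"
      using Uw v dU by auto
    moreover have "w = 0\<^sub>v n" if "\<forall>i<n. w $ i = 0"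
      using w that by (intro eq_vecI) auto
    ultimately obtain i where i: "i < n" "w $ i \<noteq> 0"
      by blast
    have "mat_diag n (\<lambda>i. complex_of_real (d i)) *\<^sub>v w = (mat_adjoint U * T) *\<^sub>v v"
      unfolding T w_def using dU v by (simp add: mat_dim_simps inv assoc_mult_mat_vec_dim)
    also have "\<dots> = mat_adjoint U *\<^sub>v (e \<cdot>\<^sub>v v)"
      using dT dU v by (simp add: assoc_mult_mat_vec_dim)
    also have "\<dots> = e \<cdot>\<^sub>v w"
      using dU v by (simp add: w_def mult_mat_vec[of _ n n])
    finally have "(mat_diag n (\<lambda>i. complex_of_real (d i)) *\<^sub>v w) $ i = e * w $ i"
      using i w by simp
    moreover have "(mat_diag n (\<lambda>i. complex_of_real (d i)) *\<^sub>v w) $ i = complex_of_real (d i) * w $ i"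
      using i w by (simp add: mat_diag_def scalar_prod_def if_distrib[of "\<lambda>x. x * _"] cong: if_cong)
    ultimately have "e = complex_of_real (d i)"
      using i by simp
    then show "e \<in> complex_of_real ` I"
      using d i by auto
  qed
qed

lemma spectrum_in_mat_fun:
  assumes "self_adjoint n T"
  shows "spectrum_in (mat_fun f T) I \<longleftrightarrow> spectrum_in T {t. f t \<in> I}"
proof -
  obtain U d where U: "unitary n U" and T: "T = U * mat_diag n (\<lambda>i. complex_of_real (d i)) * mat_adjoint U"
    using self_adjoint_unitarily_diagonalizable[OF assms] by blast
  show ?thesis
    using spectrum_in_diagonalization[OF U T] spectrum_in_diagonalization[OF U mat_fun_eqI[OF U T]]
    by simp
qed

lemma mat_fun_cong:
  assumes "self_adjoint n T" "spectrum_in T I" "\<And>t. t \<in> I \<Longrightarrow> f t = g t"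
  shows "mat_fun f T = mat_fun g T"
proof -
  obtain U d where U: "unitary n U" and T: "T = U * mat_diag n (\<lambda>i. complex_of_real (d i)) * mat_adjoint U"
    using self_adjoint_unitarily_diagonalizable[OF assms(1)] by blast
  have "mat_diag n (\<lambda>i. complex_of_real (f (d i))) = mat_diag n (\<lambda>i. complex_of_real (g (d i)))"
    using spectrum_in_diagonalization[OF U T, of I] assms(2,3)
    by (intro eq_matI) (auto simp: mat_diag_def)
  then show ?thesis
    by (simp add: mat_fun_eqI[OF U T])
qed

text \<open>Eigenvalues of a self-adjoint matrix are real, so only eigenvalues of the form
  \<open>complex_of_real e\<close> have to be tested.\<close>

lemma self_adjoint_spectrum_inI:
  assumes T: "self_adjoint n T"
    and I: "\<And>e v. v \<in> carrier_vec n \<Longrightarrow> v \<noteq> 0\<^sub>v n \<Longrightarrow> T *\<^sub>v v = complex_of_real e \<cdot>\<^sub>v v \<Longrightarrow> e \<in> I"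
  shows "spectrum_in T I"
  unfolding spectrum_in_def
proof
  fix e assume "e \<in> spectrum T"
  then obtain v where ev: "eigenvector T v e"
    by (auto simp: spectrum_def eigenvalue_def)
  have e: "e = complex_of_real (Re e)"
    using self_adjoint_eigenvalue_real[OF T ev] .
  have "Re e \<in> I"
    using ev self_adjointD[OF T] e by (intro I[of v]) (auto simp: eigenvector_def)
  then show "e \<in> complex_of_real ` I"
    using e by blast
qed

section \<open>Loewner order and Jensen's inequality\<close>

abbreviation quadratic_form :: "complex mat \<Rightarrow> complex vec \<Rightarrow> real" where
  "quadratic_form A v \<equiv> Re ((A *\<^sub>v v) \<bullet>c v)"

lemma quadratic_form_add:
  assumes "A \<in> carrier_mat n n" "B \<in> carrier_mat n n" "v \<in> carrier_vec n"
  shows "quadratic_form (A + B) v = quadratic_form A v + quadratic_form B v"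
  using assms by (simp add: add_mult_distrib_mat_vec[of _ n n] add_scalar_prod_distrib[of _ n])

lemma quadratic_form_minus:
  assumes "A \<in> carrier_mat n n" "B \<in> carrier_mat n n" "v \<in> carrier_vec n"
  shows "quadratic_form (A - B) v = quadratic_form A v - quadratic_form B v"
  using assms by (simp add: minus_mult_distrib_mat_vec[of _ n n] minus_scalar_prod_distrib[of _ n])

lemma quadratic_form_uminus:
  assumes "A \<in> carrier_mat n n" "v \<in> carrier_vec n"
  shows "quadratic_form (- A) v = - quadratic_form A v"
  using assms by simp

lemma quadratic_form_smult:
  assumes "A \<in> carrier_mat n n" "v \<in> carrier_vec n"
  shows "quadratic_form (complex_of_real c \<cdot>\<^sub>m A) v = c * quadratic_form A v"
proof -
  have "(complex_of_real c \<cdot>\<^sub>m A) *\<^sub>v v = complex_of_real c \<cdot>\<^sub>v (A *\<^sub>v v)"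
    using assms by (intro eq_vecI) auto
  then show ?thesis
    using assms by simp
qed

lemma quadratic_form_congruence:
  assumes "A \<in> carrier_mat n n" "V \<in> carrier_mat n m" "v \<in> carrier_vec m"
  shows "quadratic_form (mat_adjoint V * A * V) v = quadratic_form A (V *\<^sub>v v)"
proof -
  have "(mat_adjoint V * A * V) *\<^sub>v v = mat_adjoint V *\<^sub>v (A *\<^sub>v (V *\<^sub>v v))"
    using assms by (simp add: assoc_mult_mat_vec_dim mat_dim_simps)
  then show ?thesis
    using assms cscalar_prod_mat_adjoint[of "A *\<^sub>v (V *\<^sub>v v)" "mat_adjoint V" v] by simp
qed

lemma self_adjoint_add: "self_adjoint n A \<Longrightarrow> self_adjoint n B \<Longrightarrow> self_adjoint n (A + B)"
  by (auto simp: self_adjoint_def mat_adjoint_add)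

lemma self_adjoint_minus: "self_adjoint n A \<Longrightarrow> self_adjoint n B \<Longrightarrow> self_adjoint n (A - B)"
  by (auto simp: self_adjoint_def mat_adjoint_minus intro: minus_carrier_mat)

lemma self_adjoint_smult: "self_adjoint n A \<Longrightarrow> self_adjoint n (complex_of_real c \<cdot>\<^sub>m A)"
  by (auto simp: self_adjoint_def mat_adjoint_smult_real)

lemma self_adjoint_zero: "self_adjoint n (0\<^sub>m n n)"
  by (simp add: self_adjoint_def)

text \<open>Since the quadratic form is linear in the matrix, Loewner inequalities become numerical
  inequalities for each vector, which is how they are combined and chained below.\<close>

lemma loewner_le_iff:
  "loewner_le n X Y \<longleftrightarrow> self_adjoint n X \<and> self_adjoint n Y \<and>
    (\<forall>v \<in> carrier_vec n. quadratic_form X v \<le> quadratic_form Y v)"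
proof -
  have "quadratic_form (Y - X) v = quadratic_form Y v - quadratic_form X v"
    if "self_adjoint n X" "self_adjoint n Y" "v \<in> carrier_vec n" for v
    using that self_adjointD(1) by (intro quadratic_form_minus) auto
  then show ?thesis
    by (auto simp: loewner_le_def positive_semidefinite_def self_adjoint_minus)
qed

lemma loewner_le_congruence:
  assumes "loewner_le n X Y" "V \<in> carrier_mat n m"
  shows "loewner_le m (mat_adjoint V * X * V) (mat_adjoint V * Y * V)"
proof -
  have "quadratic_form (mat_adjoint V * X * V) v \<le> quadratic_form (mat_adjoint V * Y * V) v"
    if "v \<in> carrier_vec m" for v
  proof -
    have "V *\<^sub>v v \<in> carrier_vec n"
      using assms(2) that by simp
    then show ?thesis
      using assms that self_adjointD(1) by (auto simp: loewner_le_iff quadratic_form_congruence[of _ n _ m])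
  qed
  then show ?thesis
    using assms by (auto simp: loewner_le_iff self_adjoint_congruence)
qed

section \<open>Convexity under compression by an isometry\<close>

text \<open>If \<open>W\<close> diagonalizes \<open>T\<close>, then \<open>U * W\<close>
  diagonalizes the conjugate with the same diagonal entries.\<close>

lemma spectrum_in_unitary_conjugate:
  assumes T: "self_adjoint n T" "spectrum_in T I" and U: "unitary n U"
  shows "spectrum_in (U * T * mat_adjoint U) I"
proof -
  obtain W d where W: "unitary n W" and TW: "T = W * mat_diag n (\<lambda>i. complex_of_real (d i)) * mat_adjoint W"
    using self_adjoint_unitarily_diagonalizable[OF T(1)] by blast
  have "U * T * mat_adjoint U = (U * W) * mat_diag n (\<lambda>i. complex_of_real (d i)) * mat_adjoint (U * W)"
    unfolding TW using unitaryD(1-3)[OF U] unitaryD(1-3)[OF W] by (simp add: mat_dim_simps adjoint_dim_simps)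
  from spectrum_in_diagonalization[OF unitary_mult[OF U W] this]
  show ?thesis
    using spectrum_in_diagonalization[OF W TW, of I] T(2) by simp
qed

text \<open>The pinching argument: for the reflection \<open>U = 2 V V\<^sup>* - 1\<close> the average of \<open>X\<close> and
  \<open>U X U\<close> leaves the range of \<open>V\<close> invariant and restricts there to \<open>V\<^sup>* X V\<close>.\<close>

lemma matrix_convex_isometry:
  assumes f: "matrix_convex I f" and X: "self_adjoint N X" "spectrum_in X I"
    and V: "V \<in> carrier_mat N n" "mat_adjoint V * V = 1\<^sub>m n"
  shows "loewner_le n (mat_fun f (mat_adjoint V * X * V)) (mat_adjoint V * mat_fun f X * V)"
proof -
  note dX = self_adjointD[OF X(1)] and dV = carrier_matD[OF V(1)]
  note dfX = self_adjointD[OF mat_fun_self_adjoint[OF X(1)], of f]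
  define Z where "Z = mat_adjoint V * X * V"
  have Z: "self_adjoint n Z"
    unfolding Z_def using X(1) V(1) by (rule self_adjoint_congruence)
  have Vinv: "mat_adjoint V * (V * M) = M" if "dim_row M = n" for M
    using V dV that by (simp add: mult_mat_left_cancel)
  define U where "U = complex_of_real 2 \<cdot>\<^sub>m (V * mat_adjoint V) - 1\<^sub>m N"
  have dU: "U \<in> carrier_mat N N" "dim_row U = N" "dim_col U = N"
    using dV by (auto simp: U_def intro!: carrier_matI)
  have U_adj: "mat_adjoint U = U"
    using dV by (simp add: U_def adjoint_dim_simps del: of_real_numeral)
  have U_mult: "U * M = 2 \<cdot>\<^sub>m (V * (mat_adjoint V * M)) - M" if "dim_row M = N" for M
    using dV that by (simp add: U_def mat_dim_simps)
  have UV: "U * V = V"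
    using dV V by (simp add: U_mult) (auto intro!: eq_matI)
  have VU: "mat_adjoint V * U = mat_adjoint V"
    using arg_cong[OF UV, of mat_adjoint] dU dV U_adj by (simp add: mat_adjoint_mult)
  have UU: "U * U = 1\<^sub>m N"
  proof -
    have "U * U = 2 \<cdot>\<^sub>m (V * mat_adjoint V) - U"
      using dU by (simp add: U_mult VU)
    also have "\<dots> = 1\<^sub>m N"
      unfolding U_def using dV by (intro eq_matI) auto
    finally show ?thesis .
  qed
  have U: "unitary N U"
    using dU UU U_adj by (simp add: unitary_def)
  define X' where "X' = U * X * U"
  have X': "self_adjoint N X'" "spectrum_in X' I"
    using self_adjoint_congruence[OF X(1) dU(1)] spectrum_in_unitary_conjugate[OF X U]
    by (simp_all add: X'_def U_adj)
  note dX' = self_adjointD[OF X'(1)] and dfX' = self_adjointD[OF mat_fun_self_adjoint[OF X'(1)], of f]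
  define Y where "Y = complex_of_real (1/2) \<cdot>\<^sub>m X + complex_of_real (1 - 1/2) \<cdot>\<^sub>m X'"
  have Y: "self_adjoint N Y"
    unfolding Y_def using X X' by (intro self_adjoint_add self_adjoint_smult) auto
  note dY = self_adjointD[OF Y] and dfY = self_adjointD[OF mat_fun_self_adjoint[OF Y], of f]
  \<comment> \<open>Convexity at the midpoint; the second weight stays in the form 1 - 1/2 to match
    \<open>matrix_convex\<close>.\<close>
  have le: "loewner_le N (mat_fun f Y)
      (complex_of_real (1/2) \<cdot>\<^sub>m mat_fun f X + complex_of_real (1 - 1/2) \<cdot>\<^sub>m mat_fun f X')"
    unfolding Y_def by (rule f[unfolded matrix_convex_def, rule_format]) (use X X' in auto)
  have X'V: "X' * V = U * (X * V)"
    using dX dU dV by (simp add: X'_def mat_dim_simps UV)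
  \<comment> \<open>Half of \<open>U * (X * V)\<close> is V V* X V minus half of
    \<open>X * V\<close>, and the latter cancels the first summand. Hence \<open>V\<close>
    intertwines \<open>Y\<close> with \<open>Z\<close>, and therefore f(Y) with f(Z).\<close>
  have "Y * V = complex_of_real (1/2) \<cdot>\<^sub>m (X * V) + complex_of_real (1 - 1/2) \<cdot>\<^sub>m (U * (X * V))"
    using dX dX' dV by (simp add: Y_def mat_dim_simps X'V)
  also have "\<dots> = V * (mat_adjoint V * (X * V))"
    using dX dV by (subst U_mult) (auto intro!: eq_matI simp: field_simps)
  also have "\<dots> = V * Z"
    using dX dV by (simp add: Z_def mat_dim_simps)
  finally have "mat_fun f Y * V = V * mat_fun f Z"
    using Y Z V by (intro mat_fun_intertwines) auto
  then have lhs: "mat_adjoint V * mat_fun f Y * V = mat_fun f Z"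
    using dfY dV self_adjointD[OF mat_fun_self_adjoint[OF Z], of f] by (simp add: mat_dim_simps Vinv)
  \<comment> \<open>\<open>U\<close> intertwines \<open>X'\<close> with \<open>X\<close>, hence also
    f(X') with f(X). As \<open>U\<close> fixes \<open>V\<close> and the adjoint of \<open>V\<close>
    absorbs \<open>U\<close>, both have the same compression, so the average on the right collapses
    to V* f(X) V.\<close>
  have "X' * U = U * X"
    using dX dU by (simp add: X'_def mat_dim_simps UU)
  then have "mat_fun f X' * U = U * mat_fun f X"
    using X X' dU by (intro mat_fun_intertwines) auto
  then have "mat_fun f X' * (U * V) = U * (mat_fun f X * V)"
    using dfX dfX' dU dV by (metis assoc_mult_mat_dim)
  then have "mat_adjoint V * (mat_fun f X' * V) = mat_adjoint V * U * (mat_fun f X * V)"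
    using dfX dU dV by (simp add: UV mat_dim_simps)
  then have X'_compress: "mat_adjoint V * (mat_fun f X' * V) = mat_adjoint V * (mat_fun f X * V)"
    by (simp add: VU)
  have rhs: "mat_adjoint V * (complex_of_real (1/2) \<cdot>\<^sub>m mat_fun f X + complex_of_real (1 - 1/2) \<cdot>\<^sub>m mat_fun f X') * V
      = mat_adjoint V * mat_fun f X * V"
    using dfX dfX' dV by (simp add: mat_dim_simps X'_compress) (auto intro!: eq_matI)
  show ?thesis
    using loewner_le_congruence[OF le V(1)] unfolding lhs rhs Z_def .
qed

section \<open>Block embeddings and Jensen's inequality for three matrices\<close>

text \<open>The isometry onto the \<open>k\<close>-th of three consecutive blocks of length
  \<open>n\<close>, for \<open>k < 3\<close>. These three have mutually orthogonal ranges, so a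
  block diagonal matrix is a sum of terms E_k T_k E_k* and block computations reduce to
  products.\<close>

definition block_embedding :: "nat \<Rightarrow> nat \<Rightarrow> complex mat" where
  "block_embedding n k = mat (3 * n) n (\<lambda>(i, j). if i = k * n + j then 1 else 0)"

lemma dim_block_embedding [simp]:
  "dim_row (block_embedding n k) = 3 * n" "dim_col (block_embedding n k) = n"
  by (simp_all add: block_embedding_def)

lemma block_index_eq_iff:
  fixes i j k l n :: nat
  assumes "i < n" "j < n"
  shows "k * n + i = l * n + j \<longleftrightarrow> k = l \<and> i = j"
proof
  assume eq: "k * n + i = l * n + j"
  have "(k * n + i) div n = k" "(l * n + j) div n = l"
    using assms by auto
  with eq show "k = l \<and> i = j"
    by auto
qed auto

lemma block_embedding_adjoint_mult:
  assumes "k < 3" "l < 3"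
  shows "mat_adjoint (block_embedding n k) * block_embedding n l = (if k = l then 1\<^sub>m n else 0\<^sub>m n n)"
proof (rule eq_matI)
  fix i j
  assume "i < dim_row (if k = l then 1\<^sub>m n else 0\<^sub>m n n :: complex mat)"
    "j < dim_col (if k = l then 1\<^sub>m n else 0\<^sub>m n n :: complex mat)"
  then have ij: "i < n" "j < n"
    by (auto split: if_splits)
  have "k * n \<le> 2 * n"
    using assms by (intro mult_le_mono1) auto
  then have k: "k * n + i < 3 * n"
    using ij by linarith
  have "(mat_adjoint (block_embedding n k) * block_embedding n l) $$ (i, j) =
      (\<Sum>m<3 * n. cnj (if m = k * n + i then 1 else 0) * (if m = l * n + j then 1 else 0))"
    using ij by (simp add: block_embedding_def scalar_prod_def atLeast0LessThan)
  also have "\<dots> = (\<Sum>m<3 * n. if m = k * n + i then (if m = l * n + j then 1 else 0) else 0)"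
    by (intro sum.cong) auto
  also have "\<dots> = (if k * n + i = l * n + j then 1 else 0)"
    using k by (subst sum.delta) auto
  finally show "(mat_adjoint (block_embedding n k) * block_embedding n l) $$ (i, j) =
      (if k = l then 1\<^sub>m n else 0\<^sub>m n n) $$ (i, j)"
    using ij by (auto simp: block_index_eq_iff)
qed auto

text \<open>Coordinate \<open>i\<close> of \<open>v\<close> is coordinate \<open>i mod n\<close> of
  its component in block \<open>i div n\<close>. Hence an eigenvector of a direct sum has a nonzero
  component in some block.\<close>

lemma block_embedding_jointly_injective:
  assumes v: "v \<in> carrier_vec (3 * n)"
    and zero: "\<And>k. k < 3 \<Longrightarrow> mat_adjoint (block_embedding n k) *\<^sub>v v = 0\<^sub>v n"
  shows "v = 0\<^sub>v (3 * n)"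
proof (rule eq_vecI)
  fix i assume "i < dim_vec (0\<^sub>v (3 * n) :: complex vec)"
  then have i: "i < 3 * n"
    by simp
  then have n: "n > 0"
    by (cases n) auto
  define k j where "k = i div n" and "j = i mod n"
  have k: "k < 3" and j: "j < n" and ikj: "i = k * n + j"
    using i n by (auto simp: k_def j_def less_mult_imp_div_less)
  have "(mat_adjoint (block_embedding n k) *\<^sub>v v) $ j = (\<Sum>m<3 * n. cnj (if m = i then 1 else 0) * v $ m)"
    using j v by (simp add: block_embedding_def scalar_prod_def atLeast0LessThan ikj)
  also have "\<dots> = (\<Sum>m<3 * n. if m = i then v $ m else 0)"
    by (intro sum.cong) auto
  also have "\<dots> = v $ i"
    using i by simp
  finally show "v $ i = 0\<^sub>v (3 * n) $ i"
    using zero[OF k] i j by simp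
qed (use v in auto)

text \<open>The direct sum \<open>X\<close> of the three \<open>T k\<close> is compressed by the
  column \<open>V\<close> with entries \<open>A k\<close>, which is an isometry by the hypothesis
  \<open>sum\<close>. Since \<open>f\<close> acts on \<open>X\<close> blockwise, both compressions
  expand to the sums displayed.\<close>

lemma matrix_convex_three:
  fixes T A :: "nat \<Rightarrow> complex mat"
  assumes f: "matrix_convex I f"
    and T: "\<And>k. k < 3 \<Longrightarrow> self_adjoint n (T k)" "\<And>k. k < 3 \<Longrightarrow> spectrum_in (T k) I"
    and A: "\<And>k. k < 3 \<Longrightarrow> A k \<in> carrier_mat n n"
    and sum: "mat_adjoint (A 0) * A 0 + mat_adjoint (A 1) * A 1 + mat_adjoint (A 2) * A 2 = 1\<^sub>m n"
  shows "loewner_le n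
    (mat_fun f (mat_adjoint (A 0) * T 0 * A 0 + mat_adjoint (A 1) * T 1 * A 1 + mat_adjoint (A 2) * T 2 * A 2))
    (mat_adjoint (A 0) * mat_fun f (T 0) * A 0 + mat_adjoint (A 1) * mat_fun f (T 1) * A 1 +
      mat_adjoint (A 2) * mat_fun f (T 2) * A 2)"
proof -
  define E where "E k = block_embedding n k" for k
  have dE: "E k \<in> carrier_mat (3 * n) n" "dim_row (E k) = 3 * n" "dim_col (E k) = n" for k
    by (auto simp: E_def intro!: carrier_matI)
  have EE: "mat_adjoint (E k) * (E l * M) = (if k = l then M else 0\<^sub>m n (dim_col M))"
    if "k < 3" "l < 3" "dim_row M = n" for k l M
  proof -
    have "mat_adjoint (E k) * (E l * M) = (mat_adjoint (E k) * E l) * M"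
      using that dE by (intro assoc_mult_mat_dim[symmetric]) auto
    then show ?thesis
      using that by (simp add: E_def block_embedding_adjoint_mult)
  qed
  have dT: "dim_row (T k) = n" "dim_col (T k) = n" "mat_adjoint (T k) = T k" if "k < 3" for k
    using self_adjointD[OF T(1)[OF that]] by auto
  have fT: "self_adjoint n (mat_fun f (T k))" if "k < 3" for k
    using mat_fun_self_adjoint[OF T(1)[OF that]] .
  have dfT: "dim_row (mat_fun f (T k)) = n" "dim_col (mat_fun f (T k)) = n" if "k < 3" for k
    using self_adjointD[OF fT[OF that]] by auto
  have dA: "dim_row (A k) = n" "dim_col (A k) = n" if "k < 3" for k
    using A[OF that] by auto
  have add0: "M + 0\<^sub>m n n = M" "0\<^sub>m n n + M = M" if "dim_row M = n" "dim_col M = n" for M :: "complex mat"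
    using that by (auto intro!: eq_matI)
  define X where "X = E 0 * T 0 * mat_adjoint (E 0) + E 1 * T 1 * mat_adjoint (E 1) + E 2 * T 2 * mat_adjoint (E 2)"
  define V where "V = E 0 * A 0 + E 1 * A 1 + E 2 * A 2"
  have X: "self_adjoint (3 * n) X"
    unfolding X_def using self_adjoint_congruence[OF T(1) mat_adjoint_carrier[OF dE(1)]]
    by (intro self_adjoint_add) (simp_all del: One_nat_def)
  note dX = self_adjointD[OF X]
  note dfX = self_adjointD[OF mat_fun_self_adjoint[OF X], of f]
  have V: "V \<in> carrier_mat (3 * n) n"
    using dE dA by (auto simp: V_def intro!: carrier_matI)
  have V_adj: "mat_adjoint V = mat_adjoint (A 0) * mat_adjoint (E 0) + mat_adjoint (A 1) * mat_adjoint (E 1)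
      + mat_adjoint (A 2) * mat_adjoint (E 2)"
    using dE dA by (simp add: V_def adjoint_dim_simps)
  have XE: "X * E k = E k * T k" if k: "k < 3" for k
  proof -
    have *: "mat_adjoint (E l) * E k = (if k = l then 1\<^sub>m n else 0\<^sub>m n n)" if "l < 3" for l
      using that k by (auto simp: E_def block_embedding_adjoint_mult)
    have "k = 0 \<or> k = 1 \<or> k = 2"
      using k by auto
    then show ?thesis
      using dE dT by (auto simp: X_def mat_dim_simps * intro!: eq_matI)
  qed
  have EX: "mat_adjoint (E k) * X = T k * mat_adjoint (E k)" if k: "k < 3" for k
    using arg_cong[OF XE[OF k], of mat_adjoint] dE dX dT[OF k] by (simp add: mat_adjoint_mult)
  have "spectrum_in X I"
  proof (rule self_adjoint_spectrum_inI[OF X])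
    fix e v
    assume v: "v \<in> carrier_vec (3 * n)" "v \<noteq> 0\<^sub>v (3 * n)" and ev: "X *\<^sub>v v = complex_of_real e \<cdot>\<^sub>v v"
    \<comment> \<open>A nonzero block component of an eigenvector of \<open>X\<close> is, by
      \<open>EX\<close>, an eigenvector of \<open>T k\<close> for the same eigenvalue.\<close>
    obtain k where k: "k < 3" and nz: "mat_adjoint (E k) *\<^sub>v v \<noteq> 0\<^sub>v n"
      using block_embedding_jointly_injective[OF v(1)] v(2) unfolding E_def by blast
    define w where "w = mat_adjoint (E k) *\<^sub>v v"
    have "T k *\<^sub>v w = (mat_adjoint (E k) * X) *\<^sub>v v"
      unfolding w_def EX[OF k] using dE dT[OF k] v by (intro assoc_mult_mat_vec_dim[symmetric]) auto
    also have "\<dots> = mat_adjoint (E k) *\<^sub>v (complex_of_real e \<cdot>\<^sub>v v)"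
      unfolding ev[symmetric] using dE dX v by (intro assoc_mult_mat_vec_dim) auto
    also have "\<dots> = complex_of_real e \<cdot>\<^sub>v w"
      unfolding w_def using mat_adjoint_carrier[OF dE(1)] v(1) by (rule mult_mat_vec)
    finally have "eigenvector (T k) w (complex_of_real e)"
      using nz v dE dT[OF k] by (auto simp: eigenvector_def w_def intro!: carrier_vecI)
    then have "complex_of_real e \<in> spectrum (T k)"
      by (auto simp: spectrum_def eigenvalue_def)
    then show "e \<in> I"
      using T(2)[OF k] by (auto simp: spectrum_in_def)
  qed
  moreover have "mat_adjoint V * V = 1\<^sub>m n"
    unfolding V_adj unfolding V_def sum[symmetric]
    using dE dA by (simp add: mat_dim_simps EE add0)
  ultimately have le: "loewner_le n (mat_fun f (mat_adjoint V * X * V)) (mat_adjoint V * mat_fun f X * V)"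
    using f X V by (intro matrix_convex_isometry)
  have XEM: "X * (E k * M) = E k * (T k * M)" if "k < 3" "dim_row M = n" for k M
    using that dE dX dT XE by (metis assoc_mult_mat_dim)
  \<comment> \<open>The blockwise action of \<open>f\<close>: \<open>E k\<close> intertwines
    \<open>X\<close> with \<open>T k\<close>, hence f(X) with f(T_k).\<close>
  have "mat_fun f X * E k = E k * mat_fun f (T k)" if k: "k < 3" for k
    using X T(1)[OF k] dE XE[OF k] by (intro mat_fun_intertwines) auto
  then have fXEM: "mat_fun f X * (E k * M) = E k * (mat_fun f (T k) * M)" if "k < 3" "dim_row M = n" for k M
    using that dE dfX dfT by (metis assoc_mult_mat_dim)
  have "mat_adjoint V * X * V =
      mat_adjoint (A 0) * T 0 * A 0 + mat_adjoint (A 1) * T 1 * A 1 + mat_adjoint (A 2) * T 2 * A 2"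
    unfolding V_adj unfolding V_def
    using dE dA dX dT by (simp add: mat_dim_simps XEM EE add0)
  moreover have "mat_adjoint V * mat_fun f X * V =
      mat_adjoint (A 0) * mat_fun f (T 0) * A 0 + mat_adjoint (A 1) * mat_fun f (T 1) * A 1 +
      mat_adjoint (A 2) * mat_fun f (T 2) * A 2"
    unfolding V_adj unfolding V_def
    using dE dA dfX dfT by (simp add: mat_dim_simps fXEM EE add0)
  ultimately show ?thesis
    using le by simp
qed

section \<open>Jensen's inequality for contractions\<close>

text \<open>The eigenvalues of \<open>K\<close> are nonnegative, and there the real square root
  squares back to the identity function.\<close>

lemma positive_semidefinite_square_root:
  assumes "positive_semidefinite n K"
  obtains D where "self_adjoint n D" "D * D = K"
proof -
  have K: "self_adjoint n K"
    using assms by (simp add: positive_semidefinite_def)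
  have "spectrum_in K {0..}"
  proof (rule self_adjoint_spectrum_inI[OF K])
    fix e v
    assume v: "v \<in> carrier_vec n" "v \<noteq> 0\<^sub>v n" and ev: "K *\<^sub>v v = complex_of_real e \<cdot>\<^sub>v v"
    have "0 \<le> quadratic_form K v"
      using assms v by (simp add: positive_semidefinite_def)
    also have "quadratic_form K v = e * Re (v \<bullet>c v)"
      using v by (simp add: ev)
    finally have "0 \<le> e * Re (v \<bullet>c v)" .
    moreover have "0 < Re (v \<bullet>c v)"
      using v conjugate_square_greater_0_vec[OF v(1)] by (simp add: less_complex_def)
    ultimately show "e \<in> {0..}"
      by (simp add: zero_le_mult_iff)
  qed
  then have "mat_fun (\<lambda>t. sqrt t * sqrt t) K = mat_fun (\<lambda>t. t) K"
    using K by (intro mat_fun_cong) auto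
  then have "mat_fun sqrt K * mat_fun sqrt K = K"
    by (simp add: mat_fun_mult[OF K] mat_fun_ident[OF K])
  then show ?thesis
    using that mat_fun_self_adjoint[OF K] by blast
qed

theorem matrix_convex_contraction:
  assumes f: "matrix_convex I f" "0 \<in> I" "f 0 \<le> 0"
    and S: "self_adjoint n S" "spectrum_in S I" and T: "self_adjoint n T" "spectrum_in T I"
    and A: "A \<in> carrier_mat n n" and B: "B \<in> carrier_mat n n"
    and le: "loewner_le n (mat_adjoint A * A + mat_adjoint B * B) (1\<^sub>m n)"
  shows "loewner_le n (mat_fun f (mat_adjoint A * S * A + mat_adjoint B * T * B))
    (mat_adjoint A * mat_fun f S * A + mat_adjoint B * mat_fun f T * B)"
    (is "loewner_le n ?X ?Y")
proof -
  obtain D where D: "self_adjoint n D" and DD: "D * D = 1\<^sub>m n - (mat_adjoint A * A + mat_adjoint B * B)"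
    using le positive_semidefinite_square_root by (auto simp: loewner_le_def)
  note dD = self_adjointD[OF D]
  note dS = self_adjointD[OF S(1)] self_adjointD[OF mat_fun_self_adjoint[OF S(1)], of f]
  note dT = self_adjointD[OF T(1)] self_adjointD[OF mat_fun_self_adjoint[OF T(1)], of f]
  define C where "C k = (if k = 0 then A else if k = 1 then B else D)" for k :: nat
  define W where "W k = (if k = 0 then S else if k = 1 then T else 0\<^sub>m n n)" for k :: nat
  \<comment> \<open>The zero matrix has no eigenvalue other than 0, so on it \<open>f\<close> may be
    replaced by the constant \<open>f 0\<close>.\<close>
  have zero: "spectrum_in (0\<^sub>m n n) {0}"
  proof (rule self_adjoint_spectrum_inI[OF self_adjoint_zero])
    fix e v
    assume v: "v \<in> carrier_vec n" "v \<noteq> 0\<^sub>v n" and "0\<^sub>m n n *\<^sub>v v = complex_of_real e \<cdot>\<^sub>v v"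
    moreover have "0\<^sub>m n n *\<^sub>v v = 0\<^sub>v n"
      using v by (intro eq_vecI) auto
    ultimately have ev: "complex_of_real e \<cdot>\<^sub>v v = 0\<^sub>v n"
      by simp
    have "v = 0\<^sub>v n" if "e \<noteq> 0"
    proof (rule eq_vecI)
      fix i assume "i < dim_vec (0\<^sub>v n :: complex vec)"
      then show "v $ i = 0\<^sub>v n $ i"
        using arg_cong[OF ev, of "\<lambda>w. w $ i"] v(1) that by simp
    qed (use v in simp)
    with v(2) show "e \<in> {0}"
      by blast
  qed
  have f_zero: "mat_fun f (0\<^sub>m n n) = complex_of_real (f 0) \<cdot>\<^sub>m 1\<^sub>m n"
    using mat_fun_cong[OF self_adjoint_zero zero, of f "\<lambda>_. f 0"] mat_fun_const[OF self_adjoint_zero]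
    by simp
  have "spectrum_in (0\<^sub>m n n) I"
    using zero f(2) by (auto simp: spectrum_in_def)
  then have W: "self_adjoint n (W k)" "spectrum_in (W k) I" for k
    using S T self_adjoint_zero by (auto simp: W_def)
  have C: "C k \<in> carrier_mat n n" for k
    using A B dD by (simp add: C_def)
  have "mat_adjoint A * A + mat_adjoint B * B + D * D = 1\<^sub>m n"
    unfolding DD using A B by (intro eq_matI) auto
  then have "mat_adjoint (C 0) * C 0 + mat_adjoint (C 1) * C 1 + mat_adjoint (C 2) * C 2 = 1\<^sub>m n"
    using dD by (simp add: C_def)
  from matrix_convex_three[where T = W and A = C, OF f(1) W C this]
  have "loewner_le n (mat_fun f (mat_adjoint A * S * A + mat_adjoint B * T * B + D * 0\<^sub>m n n * D))
      (mat_adjoint A * mat_fun f S * A + mat_adjoint B * mat_fun f T * B +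
        D * (complex_of_real (f 0) \<cdot>\<^sub>m 1\<^sub>m n) * D)"
    using dD by (simp add: C_def W_def f_zero)
  moreover have "mat_adjoint A * S * A + mat_adjoint B * T * B + D * 0\<^sub>m n n * D =
      mat_adjoint A * S * A + mat_adjoint B * T * B"
    using A B dD dS dT by (intro eq_matI) auto
  moreover have "D * (complex_of_real (f 0) \<cdot>\<^sub>m 1\<^sub>m n) * D = complex_of_real (f 0) \<cdot>\<^sub>m (D * D)"
    using dD by (simp add: mat_dim_simps)
  ultimately have le': "loewner_le n ?X (?Y + complex_of_real (f 0) \<cdot>\<^sub>m (D * D))"
    by simp
  have Y: "self_adjoint n ?Y"
    using S T A B by (intro self_adjoint_add self_adjoint_congruence mat_fun_self_adjoint)
  \<comment> \<open>The term that \<open>D\<close> contributes is f(0) D^2; its quadratic form is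
    nonpositive because \<open>f 0 \<le> 0\<close> and D^2 is positive semidefinite.\<close>
  have "quadratic_form (?Y + complex_of_real (f 0) \<cdot>\<^sub>m (D * D)) v \<le> quadratic_form ?Y v"
    if v: "v \<in> carrier_vec n" for v
  proof -
    have DDc: "D * D \<in> carrier_mat n n"
      using dD by simp
    have "0 \<le> quadratic_form (D * D) v"
      using le v unfolding loewner_le_def DD positive_semidefinite_def by blast
    then have "f 0 * quadratic_form (D * D) v \<le> 0"
      using f(3) by (rule mult_nonpos_nonneg[rotated])
    moreover have "complex_of_real (f 0) \<cdot>\<^sub>m (D * D) \<in> carrier_mat n n"
      using DDc by simp
    ultimately show ?thesis
      unfolding quadratic_form_add[OF self_adjointD(1)[OF Y] \<open>complex_of_real (f 0) \<cdot>\<^sub>m (D * D) \<in> carrier_mat n n\<close> v]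
        quadratic_form_smult[OF DDc v] by linarith
  qed
  with le' Y show ?thesis
    unfolding loewner_le_iff by (meson order_trans)
qed

section \<open>Joint convexity of the perspective\<close>

text \<open>Evaluates the option in \<open>mat_quot\<close>: \<open>None\<close> would contradict
  that \<open>A\<close> is a unit, and two-sided inverses are unique.\<close>

lemma mat_inverse_eqI:
  fixes A :: "'a :: field mat"
  assumes A: "A \<in> carrier_mat n n" and B: "B \<in> carrier_mat n n"
    and inv: "A * B = 1\<^sub>m n" "B * A = 1\<^sub>m n"
  shows "mat_inverse A = Some B"
proof (cases "mat_inverse A")
  case None
  have "A \<in> Units (ring_mat TYPE('a) n ())"
    using A B inv by (auto simp: Units_def ring_mat_def)
  with mat_inverse(1)[OF A None, of "()"] show ?thesis
    by blast
next
  case (Some C)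
  then have C: "C * A = 1\<^sub>m n" "C \<in> carrier_mat n n"
    using mat_inverse(2)[OF A] by auto
  have "C = C * (A * B)"
    using C inv by simp
  also have "\<dots> = C * A * B"
    using C(2) A B by (rule assoc_mult_mat[symmetric])
  also have "\<dots> = B"
    using B C by simp
  finally show ?thesis
    using Some by simp
qed

text \<open>Commutation allows h(R) and its inverse to be split into square roots placed on both
  sides. In this form quotient and perspective are congruences of self-adjoint matrices, to which
  the Loewner order can be transported.\<close>

lemma perspective_symmetric_form:
  fixes h :: "real \<Rightarrow> real"
  assumes L: "self_adjoint n L" and R: "self_adjoint n R" and comm: "L * R = R * L"
    and pos: "spectrum_in R {t. 0 < h t}"
  defines "r \<equiv> mat_fun (\<lambda>t. sqrt (h t)) R" and "q \<equiv> mat_fun (\<lambda>t. 1 / sqrt (h t)) R"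
  shows "self_adjoint n r" "self_adjoint n q" "r * q = 1\<^sub>m n" "q * r = 1\<^sub>m n" "r * r = mat_fun h R"
    "mat_quot h L R = q * L * q" "perspective f h L R = r * mat_fun f (mat_quot h L R) * r"
proof -
  note dL = self_adjointD[OF L] and dR = self_adjointD[OF R]
  show r: "self_adjoint n r" and q: "self_adjoint n q"
    by (simp_all add: r_def q_def mat_fun_self_adjoint[OF R])
  note dr = self_adjointD[OF r] and dq = self_adjointD[OF q]
  \<comment> \<open>Identities between functions are needed only where \<open>h\<close> is positive,
    since the spectrum of \<open>R\<close> lies there; this yields r q = 1 and r^2 = h(R).\<close>
  have mult: "mat_fun g R * mat_fun k R = mat_fun l R" if "\<And>t. 0 < h t \<Longrightarrow> g t * k t = l t" for g k l
    unfolding mat_fun_mult[OF R] using R pos that by (intro mat_fun_cong) auto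
  have one: "mat_fun (\<lambda>_. 1) R = 1\<^sub>m n"
    using mat_fun_const[OF R, of 1] by (simp add: one_smult_mat)
  show rq: "r * q = 1\<^sub>m n" and qr: "q * r = 1\<^sub>m n" and rr: "r * r = mat_fun h R"
    unfolding r_def q_def one[symmetric] by (intro mult; simp)+
  have qr_cancel: "q * (r * M) = M" "r * (q * M) = M" if "dim_row M = n" for M
    using that qr rq dq dr by (simp_all add: mult_mat_left_cancel)
  have "mat_inverse (mat_fun h R) = Some (q * q)"
    unfolding rr[symmetric] using dr dq
    by (intro mat_inverse_eqI) (simp_all add: mat_dim_simps qr_cancel qr rq)
  moreover have Lq: "q * L = L * q"
    unfolding q_def using R R dL(1) comm[symmetric] by (rule mat_fun_intertwines)
  ultimately show quot: "mat_quot h L R = q * L * q"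
    unfolding mat_quot_def using dL dq by (simp add: mat_dim_simps)
  define T where "T = mat_quot h L R"
  have T: "self_adjoint n T"
    unfolding T_def quot using self_adjoint_congruence[OF L dq(1)] dq(4) by simp
  note dT = self_adjointD[OF T] and dfT = self_adjointD[OF mat_fun_self_adjoint[OF T], of f]
  have Rq: "R * q = q * R"
    unfolding q_def by (rule mat_fun_intertwines[OF R R dR(1) refl, symmetric])
  \<comment> \<open>\<open>T\<close> commutes with \<open>R\<close> because its factors
    \<open>q\<close> and \<open>L\<close> do. Passing first to f(T) and then to \<open>r\<close> as
    a function of \<open>R\<close> shows that f(T) commutes with \<open>r\<close>.\<close>
  have "T * R = q * (L * (q * R))"
    unfolding T_def quot using dL dR dq by (simp add: mat_dim_simps)
  also have "\<dots> = q * ((L * R) * q)"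
    unfolding Rq[symmetric] using dL dR dq by (simp add: mat_dim_simps)
  also have "\<dots> = (q * R) * (L * q)"
    unfolding comm using dL dR dq by (simp add: mat_dim_simps)
  also have "\<dots> = R * T"
    unfolding Rq[symmetric] T_def quot using dL dR dq by (simp add: mat_dim_simps)
  finally have "mat_fun f T * R = R * mat_fun f T"
    using T dR by (intro mat_fun_intertwines)
  then have "r * mat_fun f T = mat_fun f T * r"
    unfolding r_def using R dfT by (intro mat_fun_intertwines) auto
  moreover have "mat_fun f T * (r * r) = mat_fun f T * r * r"
    using dfT(2,3) dr(2,3) by (intro assoc_mult_mat_dim[symmetric]) auto
  ultimately show "perspective f h L R = r * mat_fun f (mat_quot h L R) * r"
    by (simp only: perspective_def T_def[symmetric] rr[symmetric])
qed

text \<open>One direction tests h(R) on its eigenvectors; in the other <h(R)v,v> is the squared norm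
  of \<open>r v\<close> with \<open>r\<close> invertible. This translates between bounds on
  quadratic forms and positivity of \<open>h\<close> on the spectrum.\<close>

lemma strictly_positive_mat_fun_iff:
  assumes R: "self_adjoint n R"
  shows "strictly_positive n (mat_fun h R) \<longleftrightarrow> spectrum_in R {t. 0 < h t}"
proof
  assume sp: "strictly_positive n (mat_fun h R)"
  have "spectrum_in (mat_fun h R) {0<..}"
  proof (rule self_adjoint_spectrum_inI[OF mat_fun_self_adjoint[OF R]])
    fix e v
    assume v: "v \<in> carrier_vec n" "v \<noteq> 0\<^sub>v n" and ev: "mat_fun h R *\<^sub>v v = complex_of_real e \<cdot>\<^sub>v v"
    have "0 < quadratic_form (mat_fun h R) v"
      using sp v by (simp add: strictly_positive_def)
    also have "quadratic_form (mat_fun h R) v = e * Re (v \<bullet>c v)"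
      using v by (simp add: ev)
    finally have "0 < e * Re (v \<bullet>c v)" .
    moreover have "0 < Re (v \<bullet>c v)"
      using v conjugate_square_greater_0_vec[OF v(1)] by (simp add: less_complex_def)
    ultimately show "e \<in> {0<..}"
      by (simp add: zero_less_mult_iff)
  qed
  then show "spectrum_in R {t. 0 < h t}"
    by (simp add: spectrum_in_mat_fun[OF R])
next
  assume pos: "spectrum_in R {t. 0 < h t}"
  define r where "r = mat_fun (\<lambda>t. sqrt (h t)) R"
  define q where "q = mat_fun (\<lambda>t. 1 / sqrt (h t)) R"
  \<comment> \<open>Only the facts about \<open>r\<close> and \<open>q\<close> are wanted, so the
    zero matrix, which commutes with \<open>R\<close>, stands in for \<open>L\<close>.\<close>
  note sym = perspective_symmetric_form[OF self_adjoint_zero R _ pos, folded r_def q_def]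
  have zero: "0\<^sub>m n n * R = R * 0\<^sub>m n n"
    using self_adjointD[OF R] by simp
  note dr = self_adjointD[OF sym(1)[OF zero]] and dq = self_adjointD[OF sym(2)[OF zero]]
  have "0 < quadratic_form (mat_fun h R) v" if v: "v \<in> carrier_vec n" "v \<noteq> 0\<^sub>v n" for v
  proof -
    have rv: "r *\<^sub>v v \<in> carrier_vec n"
      using dr(1) v(1) by (rule mult_mat_vec_carrier)
    have "q *\<^sub>v (r *\<^sub>v v) = (q * r) *\<^sub>v v"
      using dr dq v by (intro assoc_mult_mat_vec_dim[symmetric]) auto
    also have "\<dots> = v"
      using sym(4)[OF zero] v by simp
    finally have qrv: "q *\<^sub>v (r *\<^sub>v v) = v" .
    have "q *\<^sub>v 0\<^sub>v n = 0\<^sub>v n"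
      using dq by (intro eq_vecI) auto
    then have "r *\<^sub>v v \<noteq> 0\<^sub>v n"
      using qrv v(2) by auto
    then have "0 < Re ((r *\<^sub>v v) \<bullet>c (r *\<^sub>v v))"
      using conjugate_square_greater_0_vec[OF rv] by (simp add: less_complex_def)
    also have "(r *\<^sub>v v) \<bullet>c (r *\<^sub>v v) = (mat_adjoint r *\<^sub>v (r *\<^sub>v v)) \<bullet>c v"
      using cscalar_prod_mat_adjoint[of "r *\<^sub>v v" "mat_adjoint r" v] dr v by simp
    also have "mat_adjoint r *\<^sub>v (r *\<^sub>v v) = mat_fun h R *\<^sub>v v"
      unfolding sym(5)[OF zero, symmetric] dr(4) using dr v by (intro assoc_mult_mat_vec_dim[symmetric]) auto
    finally show ?thesis .
  qed
  then show "strictly_positive n (mat_fun h R)"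
    using mat_fun_self_adjoint[OF R] by (simp add: strictly_positive_def)
qed

lemma minus_mat_eq_0D:
  fixes A :: "'a :: group_add mat"
  assumes "A - B = 0\<^sub>m n n" "A \<in> carrier_mat n n" "B \<in> carrier_mat n n"
  shows "A = B"
proof (rule eq_matI)
  fix i j assume "i < dim_row B" "j < dim_col B"
  then show "A $$ (i, j) = B $$ (i, j)"
    using arg_cong[OF assms(1), of "\<lambda>M. M $$ (i, j)"] assms(2,3) by simp
qed (use assms in auto)

theorem theorem3p2:
  fixes I :: "real set" and f h :: "real \<Rightarrow> real" and n :: nat and c :: real
    and L\<^sub>1 L\<^sub>2 R\<^sub>1 R\<^sub>2 L R :: "complex mat"
  assumes "is_interval I" and "0 \<in> I"
    and "continuous_on I f" and "continuous_on I h"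
    and "matrix_convex I f" and "f 0 \<le> 0"
    and "matrix_concave I h" and "\<And>t. t \<in> I \<Longrightarrow> h t > 0"
    and "0 \<le> c" and "c \<le> 1"
    and "strictly_positive n L\<^sub>1" and "strictly_positive n L\<^sub>2"
    and "strictly_positive n R\<^sub>1" and "strictly_positive n R\<^sub>2"
    and "L\<^sub>1 * R\<^sub>1 - R\<^sub>1 * L\<^sub>1 = 0\<^sub>m n n" and "L\<^sub>2 * R\<^sub>2 - R\<^sub>2 * L\<^sub>2 = 0\<^sub>m n n"
    and "spectrum_in R\<^sub>1 I" and "spectrum_in R\<^sub>2 I"
    and "spectrum_in (mat_quot h L\<^sub>1 R\<^sub>1) I" and "spectrum_in (mat_quot h L\<^sub>2 R\<^sub>2) I"
    and "L = complex_of_real c \<cdot>\<^sub>m L\<^sub>1 + complex_of_real (1 - c) \<cdot>\<^sub>m L\<^sub>2"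
    and "R = complex_of_real c \<cdot>\<^sub>m R\<^sub>1 + complex_of_real (1 - c) \<cdot>\<^sub>m R\<^sub>2"
    and "L * R - R * L = 0\<^sub>m n n"
  shows "loewner_le n (perspective f h L R)
           (complex_of_real c \<cdot>\<^sub>m perspective f h L\<^sub>1 R\<^sub>1
             + complex_of_real (1 - c) \<cdot>\<^sub>m perspective f h L\<^sub>2 R\<^sub>2)"
proof -
  have sa1: "self_adjoint n L\<^sub>1" "self_adjoint n R\<^sub>1" and sa2: "self_adjoint n L\<^sub>2" "self_adjoint n R\<^sub>2"
    using assms(11-14) by (simp_all add: strictly_positive_def)
  then have sa: "self_adjoint n L" "self_adjoint n R"
    by (simp_all add: assms(21,22) self_adjoint_add self_adjoint_smult del: of_real_diff)
  have comm1: "L\<^sub>1 * R\<^sub>1 = R\<^sub>1 * L\<^sub>1"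
    using self_adjointD(1)[OF sa1(1)] self_adjointD(1)[OF sa1(2)] by (intro minus_mat_eq_0D[OF assms(15)]) auto
  have comm2: "L\<^sub>2 * R\<^sub>2 = R\<^sub>2 * L\<^sub>2"
    using self_adjointD(1)[OF sa2(1)] self_adjointD(1)[OF sa2(2)] by (intro minus_mat_eq_0D[OF assms(16)]) auto
  have comm: "L * R = R * L"
    using self_adjointD(1)[OF sa(1)] self_adjointD(1)[OF sa(2)] by (intro minus_mat_eq_0D[OF assms(23)]) auto
  have pos1: "spectrum_in R\<^sub>1 {t. 0 < h t}" and pos2: "spectrum_in R\<^sub>2 {t. 0 < h t}"
    using assms(8,17,18) by (auto simp: spectrum_in_def)
  note hR = mat_fun_self_adjoint[OF sa(2), of h] mat_fun_self_adjoint[OF sa1(2), of h]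
    mat_fun_self_adjoint[OF sa2(2), of h]
  have concave: "c * quadratic_form (mat_fun h R\<^sub>1) v + (1 - c) * quadratic_form (mat_fun h R\<^sub>2) v
      \<le> quadratic_form (mat_fun h R) v" if v: "v \<in> carrier_vec n" for v
  proof -
    have "loewner_le n (mat_fun (\<lambda>t. - h t) R)
        (complex_of_real c \<cdot>\<^sub>m mat_fun (\<lambda>t. - h t) R\<^sub>1 + complex_of_real (1 - c) \<cdot>\<^sub>m mat_fun (\<lambda>t. - h t) R\<^sub>2)"
      using assms(7) unfolding assms(22) matrix_concave_def matrix_convex_def
      using sa1(2) sa2(2) assms(9,10,17,18) by blast
    then have "quadratic_form (- mat_fun h R) v \<le> quadratic_form
        (complex_of_real c \<cdot>\<^sub>m (- mat_fun h R\<^sub>1) + complex_of_real (1 - c) \<cdot>\<^sub>m (- mat_fun h R\<^sub>2)) v"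
      using v by (simp add: loewner_le_iff mat_fun_uminus[OF sa(2)] mat_fun_uminus[OF sa1(2)] mat_fun_uminus[OF sa2(2)])
    also have "\<dots> = c * - quadratic_form (mat_fun h R\<^sub>1) v + (1 - c) * - quadratic_form (mat_fun h R\<^sub>2) v"
      using hR[THEN self_adjointD(1)] v
      by (simp only: quadratic_form_add[of _ n] quadratic_form_smult[of _ n] quadratic_form_uminus[of _ n]
          smult_carrier_mat uminus_carrier_iff_mat)
    finally show ?thesis
      using hR[THEN self_adjointD(1)] v by (simp only: quadratic_form_uminus[of _ n])
  qed
  \<comment> \<open>Concavity bounds h(R) below by a convex combination of two strictly positive
    matrices. So \<open>h\<close> is positive on the spectrum of \<open>R\<close>, and the square
    roots \<open>r\<close> and \<open>q\<close> are mutually inverse.\<close>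
  have "strictly_positive n (mat_fun h R)"
    unfolding strictly_positive_def
  proof (intro conjI ballI impI hR(1))
    fix v :: "complex vec" assume v: "v \<in> carrier_vec n" "v \<noteq> 0\<^sub>v n"
    have "0 < quadratic_form (mat_fun h R\<^sub>1) v" "0 < quadratic_form (mat_fun h R\<^sub>2) v"
      using pos1 pos2 v strictly_positive_mat_fun_iff[OF sa1(2)] strictly_positive_mat_fun_iff[OF sa2(2)]
      by (auto simp: strictly_positive_def)
    then have "0 < c * quadratic_form (mat_fun h R\<^sub>1) v + (1 - c) * quadratic_form (mat_fun h R\<^sub>2) v"
      using assms(9,10) by (cases "c = 0") (auto intro: add_pos_nonneg)
    then show "0 < quadratic_form (mat_fun h R) v"
      using concave[OF v(1)] by linarith
  qed
  then have pos: "spectrum_in R {t. 0 < h t}"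
    by (simp add: strictly_positive_mat_fun_iff[OF sa(2)])
  define r q where "r = mat_fun (\<lambda>t. sqrt (h t)) R" and "q = mat_fun (\<lambda>t. 1 / sqrt (h t)) R"
  define r\<^sub>1 q\<^sub>1 where "r\<^sub>1 = mat_fun (\<lambda>t. sqrt (h t)) R\<^sub>1" and "q\<^sub>1 = mat_fun (\<lambda>t. 1 / sqrt (h t)) R\<^sub>1"
  define r\<^sub>2 q\<^sub>2 where "r\<^sub>2 = mat_fun (\<lambda>t. sqrt (h t)) R\<^sub>2" and "q\<^sub>2 = mat_fun (\<lambda>t. 1 / sqrt (h t)) R\<^sub>2"
  note sym = perspective_symmetric_form[OF sa comm pos, folded r_def q_def]
  note sym1 = perspective_symmetric_form[OF sa1 comm1 pos1, folded r\<^sub>1_def q\<^sub>1_def]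
  note sym2 = perspective_symmetric_form[OF sa2 comm2 pos2, folded r\<^sub>2_def q\<^sub>2_def]
  define T T\<^sub>1 T\<^sub>2 where "T = mat_quot h L R" and "T\<^sub>1 = mat_quot h L\<^sub>1 R\<^sub>1" and "T\<^sub>2 = mat_quot h L\<^sub>2 R\<^sub>2"
  have T1: "self_adjoint n T\<^sub>1"
    unfolding T\<^sub>1_def sym1(6)
    by (rule self_adjoint_congruence[OF sa1(1) self_adjointD(1)[OF sym1(2)], unfolded self_adjointD(4)[OF sym1(2)]])
  have T2: "self_adjoint n T\<^sub>2"
    unfolding T\<^sub>2_def sym2(6)
    by (rule self_adjoint_congruence[OF sa2(1) self_adjointD(1)[OF sym2(2)], unfolded self_adjointD(4)[OF sym2(2)]])
  have T: "self_adjoint n T"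
    unfolding T_def sym(6)
    by (rule self_adjoint_congruence[OF sa(1) self_adjointD(1)[OF sym(2)], unfolded self_adjointD(4)[OF sym(2)]])
  note fT1 = mat_fun_self_adjoint[OF T1, of f] and fT2 = mat_fun_self_adjoint[OF T2, of f]
    and fT = mat_fun_self_adjoint[OF T, of f]
  note dims = self_adjointD(2,3)[OF sym(1)] self_adjointD(2,3)[OF sym(2)]
    self_adjointD(2,3)[OF sym1(1)] self_adjointD(2,3)[OF sym1(2)]
    self_adjointD(2,3)[OF sym2(1)] self_adjointD(2,3)[OF sym2(2)]
    self_adjointD(2,3)[OF sa(1)] self_adjointD(2,3)[OF sa1(1)] self_adjointD(2,3)[OF sa2(1)]
    self_adjointD(2,3)[OF T1] self_adjointD(2,3)[OF T2] self_adjointD(2,3)[OF T]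
    self_adjointD(2,3)[OF fT1] self_adjointD(2,3)[OF fT2] self_adjointD(2,3)[OF fT]
    self_adjointD(2,3)[OF hR(1)] self_adjointD(2,3)[OF hR(2)] self_adjointD(2,3)[OF hR(3)]
  note adj = self_adjointD(4)[OF sym(1)] self_adjointD(4)[OF sym(2)]
    self_adjointD(4)[OF sym1(1)] self_adjointD(4)[OF sym2(1)]
  have cancel: "r * (q * M) = M" "r\<^sub>1 * (q\<^sub>1 * M) = M" "r\<^sub>2 * (q\<^sub>2 * M) = M"
    "q * (r * M) = M" "q\<^sub>1 * (r\<^sub>1 * M) = M" "q\<^sub>2 * (r\<^sub>2 * M) = M" if "dim_row M = n" for M
    using that by (simp_all add: mult_mat_left_cancel dims sym(3,4) sym1(3,4) sym2(3,4))
  define A\<^sub>1 where "A\<^sub>1 = complex_of_real (sqrt c) \<cdot>\<^sub>m (r\<^sub>1 * q)"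
  define A\<^sub>2 where "A\<^sub>2 = complex_of_real (sqrt (1 - c)) \<cdot>\<^sub>m (r\<^sub>2 * q)"
  have A: "A\<^sub>1 \<in> carrier_mat n n" "A\<^sub>2 \<in> carrier_mat n n"
    using dims by (auto simp: A\<^sub>1_def A\<^sub>2_def intro!: carrier_matI)
  have root: "complex_of_real (sqrt c) * complex_of_real (sqrt c) = complex_of_real c"
    "complex_of_real (sqrt (1 - c)) * complex_of_real (sqrt (1 - c)) = complex_of_real (1 - c)"
    using assms(9,10) by (simp_all only: of_real_mult[symmetric] real_sqrt_mult_self abs_of_nonneg diff_ge_0_iff_ge)
  \<comment> \<open>Used with three choices of \<open>M\<close>: the identity for the contraction
    bound, \<open>T\<^sub>1\<close> or \<open>T\<^sub>2\<close> to recover \<open>T\<close>, and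
    \<open>f\<close> of these for the right-hand side of Jensen's inequality.\<close>
  have A1: "mat_adjoint A\<^sub>1 * M * A\<^sub>1 = complex_of_real c \<cdot>\<^sub>m (q * (r\<^sub>1 * M * r\<^sub>1) * q)"
    and A2: "mat_adjoint A\<^sub>2 * M * A\<^sub>2 = complex_of_real (1 - c) \<cdot>\<^sub>m (q * (r\<^sub>2 * M * r\<^sub>2) * q)"
    if "dim_row M = n" "dim_col M = n" for M
    using that
    by (simp_all add: dims root A\<^sub>1_def A\<^sub>2_def adjoint_dim_simps adj mat_dim_simps del: of_real_diff)
  have "mat_adjoint A\<^sub>1 * A\<^sub>1 + mat_adjoint A\<^sub>2 * A\<^sub>2 =
      q * (complex_of_real c \<cdot>\<^sub>m mat_fun h R\<^sub>1 + complex_of_real (1 - c) \<cdot>\<^sub>m mat_fun h R\<^sub>2) * q"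
    using A A1[of "1\<^sub>m n"] A2[of "1\<^sub>m n"]
    by (simp add: dims sym1(5) sym2(5) mat_dim_simps del: of_real_diff)
  moreover have "1\<^sub>m n = q * mat_fun h R * q"
    by (simp add: dims sym(5)[symmetric] mat_dim_simps cancel sym(3))
  moreover have "loewner_le n (complex_of_real c \<cdot>\<^sub>m mat_fun h R\<^sub>1 + complex_of_real (1 - c) \<cdot>\<^sub>m mat_fun h R\<^sub>2) (mat_fun h R)"
    unfolding loewner_le_iff
  proof (intro conjI ballI self_adjoint_add self_adjoint_smult hR)
    fix v :: "complex vec" assume v: "v \<in> carrier_vec n"
    show "quadratic_form (complex_of_real c \<cdot>\<^sub>m mat_fun h R\<^sub>1 + complex_of_real (1 - c) \<cdot>\<^sub>m mat_fun h R\<^sub>2) v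
        \<le> quadratic_form (mat_fun h R) v"
      using concave[OF v] hR[THEN self_adjointD(1)] v
      by (simp only: quadratic_form_add[of _ n] quadratic_form_smult[of _ n] smult_carrier_mat)
  qed
  \<comment> \<open>The concavity inequality for \<open>h\<close> conjugated by \<open>q\<close>,
    under which h(R) becomes the identity.\<close>
  ultimately have contraction: "loewner_le n (mat_adjoint A\<^sub>1 * A\<^sub>1 + mat_adjoint A\<^sub>2 * A\<^sub>2) (1\<^sub>m n)"
    using loewner_le_congruence[OF _ self_adjointD(1)[OF sym(2)]] adj(2) by metis
  have rTr: "r\<^sub>1 * T\<^sub>1 * r\<^sub>1 = L\<^sub>1" "r\<^sub>2 * T\<^sub>2 * r\<^sub>2 = L\<^sub>2"
    by (simp_all add: dims T\<^sub>1_def T\<^sub>2_def sym1(6) sym2(6) mat_dim_simps cancel sym1(4) sym2(4))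
  have "mat_adjoint A\<^sub>1 * T\<^sub>1 * A\<^sub>1 + mat_adjoint A\<^sub>2 * T\<^sub>2 * A\<^sub>2 = T"
    unfolding T_def sym(6) unfolding assms(21)
    by (simp add: dims A1 A2 rTr mat_dim_simps del: of_real_diff)
  with matrix_convex_contraction[OF assms(5,2,6) T1 _ T2 _ A contraction]
  have "loewner_le n (mat_fun f T) (mat_adjoint A\<^sub>1 * mat_fun f T\<^sub>1 * A\<^sub>1 + mat_adjoint A\<^sub>2 * mat_fun f T\<^sub>2 * A\<^sub>2)"
    using assms(19,20) by (simp add: T\<^sub>1_def T\<^sub>2_def)
  from loewner_le_congruence[OF this self_adjointD(1)[OF sym(1)]]
  have "loewner_le n (r * mat_fun f T * r)
      (r * (mat_adjoint A\<^sub>1 * mat_fun f T\<^sub>1 * A\<^sub>1 + mat_adjoint A\<^sub>2 * mat_fun f T\<^sub>2 * A\<^sub>2) * r)"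
    by (simp add: adj)
  \<comment> \<open>The outer factors \<open>r\<close> cancel the \<open>q\<close> inside
    \<open>A\<^sub>1\<close> and \<open>A\<^sub>2\<close>, leaving the weighted perspectives in
    symmetric form.\<close>
  also have "r * (mat_adjoint A\<^sub>1 * mat_fun f T\<^sub>1 * A\<^sub>1 + mat_adjoint A\<^sub>2 * mat_fun f T\<^sub>2 * A\<^sub>2) * r =
      complex_of_real c \<cdot>\<^sub>m (r\<^sub>1 * mat_fun f T\<^sub>1 * r\<^sub>1) + complex_of_real (1 - c) \<cdot>\<^sub>m (r\<^sub>2 * mat_fun f T\<^sub>2 * r\<^sub>2)"
    by (simp add: dims A1 A2 mat_dim_simps cancel sym(4) del: of_real_diff)
  finally show ?thesis
    by (simp add: sym(7) sym1(7) sym2(7) T_def T\<^sub>1_def T\<^sub>2_def)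
qed

end
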